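(* Let $\mathbf{Mat}_\bullet$ be the category of pointed matroids and (pointed) strong maps. Let $\mathfrak{M}$ be the class of strong maps that factor as $N \xrightarrow{\ \sim\ } M|S \hookrightarrow M$ for some $S\subseteq E_M$ with $*_M\in S$ (matroid restrictions), and let $\mathfrak{E}$ be the class of strong maps that factor as $M \twoheadrightarrow M/S \xrightarrow{\ \sim\ } N$ for some $S\subseteq E_M$ with $*_M\notin S$ (matroid contractions). Then $(\mathbf{Mat}_\bullet,\mathfrak{M},\mathfrak{E})$ is a finitary proto-exact category.
   Context: Matroids. A matroid $M$ on a finite ground set $E=E_M$ is given by a flats operator $\sigma:2^E\to 2^E$ satisfying, for all $S\subseteq T\subseteq E$: $S\subseteq\sigma S$; $\sigma\sigma=\sigma$; $\sigma S\subseteq \sigma T$; and for all $x\in E$ and $y\in\sigma(S\cup\{x\})\setminus\sigma S$ one has $x\in\sigma(S\cup\{y\})$. The flats are the sets $\sigma S$; $\mathcal F(M)$ denotes the set of flats. For $S\subseteq E$, the restriction $M|S$ is the matroid on $S$ with flats $\{A\cap S: A\in\mathcal F(M)\}$, and the contraction $M/S$ is the matroid on $E\setminus S$ with flats $\{A\setminus S: S\subseteq A\in\mathcal F(M)\}$. A loop is an element of $\sigma\emptyset$. A pointed matroid is a pair $(M,*_M)$ with $*_M$ a distinguished loop of $M$. A (pointed) strong map $f:M\to N$ of pointed matroids is a function $f:E_M\to E_N$ with $f( *_M)=*_N$ and $f^{-1}A\in\mathcal F(N)$-to-$\mathcal F(M)$ compatible in the sense that $A\in\mathcal F(N)$ implies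 $f^{-1}A\in\mathcal F(M)$. Canonical maps. If $*_M\in S$, then $M|S$ is pointed by $*_M$ and $M|S\hookrightarrow M$ is the inclusion $S\subseteq E_M$. If $*_M\notin S$, then $M/S$ is pointed by $*_M$ and $M\twoheadrightarrow M/S$ is the map $E_M\to E_M\setminus S$ that sends every element of $S$ to $*_M$ and is the identity on $E_M\setminus S$. Proto-exact categories. A commutative square is biCartesian if it is both Cartesian and co-Cartesian. A proto-exact category is a category $\mathcal E$ with two classes of morphisms $\mathfrak M$ (admissible monomorphisms) and $\mathfrak E$ (admissible epimorphisms) such that: (1) $\mathcal E$ has a zero object $0$, every morphism $0\to A$ is in $\mathfrak M$ and every morphism $A\to 0$ is in $\mathfrak E$; (2) $\mathfrak M$ and $\mathfrak E$ are closed under composition and contain all isomorphisms; (3) a commutative square with top $i:A\to B$, bottom $i':A'\to B'$, left $j:A\to A'$, right $j':B\to B'$, where $i,i'\in\mathfrak M$ and $j,j'\in\mathfrak E$, is Cartesian iff it is co-Cartesian; (4) every diagram $A'\xrightarrow{i'}B'\xleftarrow{j'}B$ with $i'\in\mathfrak M$, $j'\in\mathfrak E$ can be completed to a biCartesian square of this shape with $i\in\mathfrak M$, $j\in\mathfrak E$; (5) every diagram $A'\xleftarrow{j}A\xrightarrow{i}B$ with $i\in\mathfrak M$, $j\in\mathfrak E$ can be completed to a biCartesian square of this shape with $i'\in\mathfrak M$, $j'\in\mathfrak E$. An admissible short exact sequence $A\hookrightarrow B\twoheadrightarrow C$ (an extension of $C$ by $A$) is a biCartesian square with top $A\to B$ and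 bottom $0\to C$ in $\mathfrak M$, and left $A\to 0$ and right $B\to C$ in $\mathfrak E$. Two extensions $A\hookrightarrow B\twoheadrightarrow C$ and $A\hookrightarrow B'\twoheadrightarrow C$ are equivalent if there is an isomorphism $B\to B'$ compatible with the identities of $A$ and $C$; $\mathrm{Ext}_{\mathcal E}(C,A)$ is the set of equivalence classes. $\mathcal E$ is finitary if $\mathrm{Hom}_{\mathcal E}(A,B)$ and $\mathrm{Ext}_{\mathcal E}(A,B)$ are finite for all objects $A,B$. *)

theory Defs
  imports Main "HOL-Library.FuncSet"
begin

section \<open>Categories\<close>

record ('o, 'm) cat =
  Ob :: "'o set"
  Ar :: "'m set"
  Dom :: "'m \<Rightarrow> 'o"
  Cod :: "'m \<Rightarrow> 'o"
  Idn :: "'o \<Rightarrow> 'm"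
  Comp :: "'m \<Rightarrow> 'm \<Rightarrow> 'm"  (infixl "\<cdot>\<index>" 70)

definition Hom :: "('o, 'm, 'z) cat_scheme \<Rightarrow> 'o \<Rightarrow> 'o \<Rightarrow> 'm set" where
  "Hom C A B = {f \<in> Ar C. Dom C f = A \<and> Cod C f = B}"

locale category =
  fixes C (structure)
  assumes Dom_in_Ob: "f \<in> Ar C \<Longrightarrow> Dom C f \<in> Ob C"
    and Cod_in_Ob: "f \<in> Ar C \<Longrightarrow> Cod C f \<in> Ob C"
    and Idn_in_Hom: "A \<in> Ob C \<Longrightarrow> Idn C A \<in> Hom C A A"
    and Comp_in_Hom: "f \<in> Hom C A B \<Longrightarrow> g \<in> Hom C B D \<Longrightarrow> g \<cdot> f \<in> Hom C A D"
    and Comp_Idn: "f \<in> Hom C A B \<Longrightarrow> f \<cdot> Idn C A = f"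
    and Idn_Comp: "f \<in> Hom C A B \<Longrightarrow> Idn C B \<cdot> f = f"
    and Comp_assoc: "f \<in> Hom C A B \<Longrightarrow> g \<in> Hom C B D \<Longrightarrow> h \<in> Hom C D E \<Longrightarrow>
      h \<cdot> (g \<cdot> f) = h \<cdot> g \<cdot> f"

definition isomorphisms :: "('o, 'm, 'z) cat_scheme \<Rightarrow> 'm set" where
  "isomorphisms C = {f \<in> Ar C. \<exists>g \<in> Hom C (Cod C f) (Dom C f).
     g \<cdot>\<^bsub>C\<^esub> f = Idn C (Dom C f) \<and> f \<cdot>\<^bsub>C\<^esub> g = Idn C (Cod C f)}"

definition zero_object :: "('o, 'm, 'z) cat_scheme \<Rightarrow> 'o \<Rightarrow> bool" where
  "zero_object C Z \<longleftrightarrow> Z \<in> Ob C \<and>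
     (\<forall>A \<in> Ob C. (\<exists>!f. f \<in> Hom C Z A) \<and> (\<exists>!f. f \<in> Hom C A Z))"

text \<open>
  In all predicates on squares the arguments are, in this order, the top, left, right and
  bottom morphisms \<open>i : A \<rightarrow> B\<close>, \<open>j : A \<rightarrow> A'\<close>, \<open>j' : B \<rightarrow> B'\<close>, \<open>i' : A' \<rightarrow> B'\<close>.
\<close>

definition commutative_square ::
    "('o, 'm, 'z) cat_scheme \<Rightarrow> 'm \<Rightarrow> 'm \<Rightarrow> 'm \<Rightarrow> 'm \<Rightarrow> bool" where
  "commutative_square C i j j' i' \<longleftrightarrow>
     i \<in> Ar C \<and> j \<in> Ar C \<and> j' \<in> Ar C \<and> i' \<in> Ar C \<and>
     Dom C i = Dom C j \<and> Cod C i = Dom C j' \<and> Cod C j = Dom C i' \<and> Cod C j' = Cod C i' \<and>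
     j' \<cdot>\<^bsub>C\<^esub> i = i' \<cdot>\<^bsub>C\<^esub> j"

definition cartesian ::
    "('o, 'm, 'z) cat_scheme \<Rightarrow> 'm \<Rightarrow> 'm \<Rightarrow> 'm \<Rightarrow> 'm \<Rightarrow> bool" where
  "cartesian C i j j' i' \<longleftrightarrow> commutative_square C i j j' i' \<and>
     (\<forall>T \<in> Ob C. \<forall>g \<in> Hom C T (Dom C j'). \<forall>h \<in> Hom C T (Dom C i').
        j' \<cdot>\<^bsub>C\<^esub> g = i' \<cdot>\<^bsub>C\<^esub> h \<longrightarrow>
        (\<exists>!u. u \<in> Hom C T (Dom C i) \<and> i \<cdot>\<^bsub>C\<^esub> u = g \<and> j \<cdot>\<^bsub>C\<^esub> u = h))"

definition cocartesian ::
    "('o, 'm, 'z) cat_scheme \<Rightarrow> 'm \<Rightarrow> 'm \<Rightarrow> 'm \<Rightarrow> 'm \<Rightarrow> bool" where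
  "cocartesian C i j j' i' \<longleftrightarrow> commutative_square C i j j' i' \<and>
     (\<forall>T \<in> Ob C. \<forall>g \<in> Hom C (Cod C i) T. \<forall>h \<in> Hom C (Cod C j) T.
        g \<cdot>\<^bsub>C\<^esub> i = h \<cdot>\<^bsub>C\<^esub> j \<longrightarrow>
        (\<exists>!u. u \<in> Hom C (Cod C i') T \<and> u \<cdot>\<^bsub>C\<^esub> j' = g \<and> u \<cdot>\<^bsub>C\<^esub> i' = h))"

definition bicartesian ::
    "('o, 'm, 'z) cat_scheme \<Rightarrow> 'm \<Rightarrow> 'm \<Rightarrow> 'm \<Rightarrow> 'm \<Rightarrow> bool" where
  "bicartesian C i j j' i' \<longleftrightarrow> cartesian C i j j' i' \<and> cocartesian C i j j' i'"


section \<open>Proto-exact categories\<close>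

locale proto_exact_category = category C for C (structure) +
  fixes MM EE
  assumes MM_Ar: "MM \<subseteq> Ar C"
    and EE_Ar: "EE \<subseteq> Ar C"
    and zero: "\<exists>Z. zero_object C Z \<and> (\<forall>A \<in> Ob C. Hom C Z A \<subseteq> MM \<and> Hom C A Z \<subseteq> EE)"
    and MM_Comp: "f \<in> MM \<Longrightarrow> g \<in> MM \<Longrightarrow> Cod C f = Dom C g \<Longrightarrow> g \<cdot> f \<in> MM"
    and EE_Comp: "f \<in> EE \<Longrightarrow> g \<in> EE \<Longrightarrow> Cod C f = Dom C g \<Longrightarrow> g \<cdot> f \<in> EE"
    and iso_MM: "isomorphisms C \<subseteq> MM"
    and iso_EE: "isomorphisms C \<subseteq> EE"
    and cartesian_iff_cocartesian:
      "i \<in> MM \<Longrightarrow> i' \<in> MM \<Longrightarrow> j \<in> EE \<Longrightarrow> j' \<in> EE \<Longrightarrow> commutative_square C i j j' i' \<Longrightarrow>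
       cartesian C i j j' i' \<longleftrightarrow> cocartesian C i j j' i'"
    and complete_cospan:
      "i' \<in> MM \<Longrightarrow> j' \<in> EE \<Longrightarrow> Cod C i' = Cod C j' \<Longrightarrow>
       \<exists>i \<in> MM. \<exists>j \<in> EE. bicartesian C i j j' i'"
    and complete_span:
      "i \<in> MM \<Longrightarrow> j \<in> EE \<Longrightarrow> Dom C i = Dom C j \<Longrightarrow>
       \<exists>i' \<in> MM. \<exists>j' \<in> EE. bicartesian C i j j' i'"

text \<open>
  An extension of \<open>D\<close> by \<open>A\<close> is recorded by its two outer morphisms \<open>i : A \<rightarrow> B\<close> and
  \<open>p : B \<rightarrow> D\<close>; the other two sides of the square are determined by the choice of a zero object.
\<close>

definition extensions ::
    "('o, 'm, 'z) cat_scheme \<Rightarrow> 'm set \<Rightarrow> 'm set \<Rightarrow> 'o \<Rightarrow> 'o \<Rightarrow> ('m \<times> 'm) set" where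
  "extensions C MM EE D A = {(i, p). i \<in> MM \<and> p \<in> EE \<and> Dom C i = A \<and> Cod C p = D \<and>
     (\<exists>Z. zero_object C Z \<and>
       (\<exists>l \<in> EE \<inter> Hom C A Z. \<exists>b \<in> MM \<inter> Hom C Z D. bicartesian C i l p b))}"

definition extension_equiv ::
    "('o, 'm, 'z) cat_scheme \<Rightarrow> 'm set \<Rightarrow> 'm set \<Rightarrow> 'o \<Rightarrow> 'o \<Rightarrow> (('m \<times> 'm) \<times> ('m \<times> 'm)) set" where
  "extension_equiv C MM EE D A = {((i, p), (i', p')).
     (i, p) \<in> extensions C MM EE D A \<and> (i', p') \<in> extensions C MM EE D A \<and>
     (\<exists>\<phi> \<in> isomorphisms C \<inter> Hom C (Cod C i) (Cod C i').
        \<phi> \<cdot>\<^bsub>C\<^esub> i = i' \<and> p' \<cdot>\<^bsub>C\<^esub> \<phi> = p)}"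

definition Ext ::
    "('o, 'm, 'z) cat_scheme \<Rightarrow> 'm set \<Rightarrow> 'm set \<Rightarrow> 'o \<Rightarrow> 'o \<Rightarrow> ('m \<times> 'm) set set" where
  "Ext C MM EE D A = extensions C MM EE D A // extension_equiv C MM EE D A"

locale finitary_proto_exact_category = proto_exact_category C MM EE
    for C (structure) and MM EE +
  assumes finite_Hom: "A \<in> Ob C \<Longrightarrow> B \<in> Ob C \<Longrightarrow> finite (Hom C A B)"
    and finite_Ext: "A \<in> Ob C \<Longrightarrow> B \<in> Ob C \<Longrightarrow> finite (Ext C MM EE A B)"


section \<open>Matroids\<close>

record 'a matroid =
  ground :: "'a set"
  cl :: "'a set \<Rightarrow> 'a set"

text \<open>
  The operator is extensional on the subsets of the ground set, so that two matroids are equal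
  as soon as their ground sets and their flats operators on subsets of the ground set agree.
\<close>

locale matroid =
  fixes M (structure)
  assumes finite_ground: "finite (ground M)"
    and cl_funcset: "cl M \<in> Pow (ground M) \<rightarrow>\<^sub>E Pow (ground M)"
    and cl_increasing: "S \<subseteq> ground M \<Longrightarrow> S \<subseteq> cl M S"
    and cl_idem: "S \<subseteq> ground M \<Longrightarrow> cl M (cl M S) = cl M S"
    and cl_mono: "S \<subseteq> T \<Longrightarrow> T \<subseteq> ground M \<Longrightarrow> cl M S \<subseteq> cl M T"
    and cl_exchange: "S \<subseteq> ground M \<Longrightarrow> x \<in> ground M \<Longrightarrow>
      y \<in> cl M (S \<union> {x}) - cl M S \<Longrightarrow> x \<in> cl M (S \<union> {y})"

definition flats :: "('a, 'z) matroid_scheme \<Rightarrow> 'a set set" where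
  "flats M = cl M ` Pow (ground M)"

text \<open>
  The flats operator of the matroid on \<open>E\<close> with set of flats \<open>F\<close> sends \<open>T\<close> to the smallest
  member of \<open>F\<close> containing \<open>T\<close>.
\<close>

definition cl_of_flats :: "'a set \<Rightarrow> 'a set set \<Rightarrow> 'a set \<Rightarrow> 'a set" where
  "cl_of_flats E F = (\<lambda>T \<in> Pow E. \<Inter> {A \<in> F. T \<subseteq> A})"

definition restriction :: "('a, 'z) matroid_scheme \<Rightarrow> 'a set \<Rightarrow> ('a, 'z) matroid_scheme" where
  "restriction M S = M\<lparr>ground := S, cl := cl_of_flats S {A \<inter> S |A. A \<in> flats M}\<rparr>"

definition contraction :: "('a, 'z) matroid_scheme \<Rightarrow> 'a set \<Rightarrow> ('a, 'z) matroid_scheme" where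
  "contraction M S = M\<lparr>ground := ground M - S,
     cl := cl_of_flats (ground M - S) {A - S |A. A \<in> flats M \<and> S \<subseteq> A}\<rparr>"

context matroid
begin

lemma flat_subset: "A \<in> flats M \<Longrightarrow> A \<subseteq> ground M"
  using cl_funcset by (auto simp: flats_def PiE_iff)

lemma flat_iff: "A \<in> flats M \<longleftrightarrow> A \<subseteq> ground M \<and> cl M A = A"
  using flat_subset cl_idem by (auto simp: flats_def image_iff)

lemma cl_flat: "S \<subseteq> ground M \<Longrightarrow> cl M S \<in> flats M"
  by (auto simp: flats_def)

lemma cl_least: "A \<in> flats M \<Longrightarrow> S \<subseteq> A \<Longrightarrow> cl M S \<subseteq> A"
  using cl_mono flat_iff by metis

lemma cl_restriction:
  assumes "S \<subseteq> ground M" "T \<subseteq> S"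
  shows "cl (restriction M S) T = cl M T \<inter> S"
proof -
  have "T \<subseteq> ground M" using assms by blast
  then have "cl M T \<inter> S \<in> {B \<in> {A \<inter> S |A. A \<in> flats M}. T \<subseteq> B}"
    using assms cl_flat cl_increasing by blast
  moreover have "cl M T \<inter> S \<subseteq> B" if "B \<in> {B \<in> {A \<inter> S |A. A \<in> flats M}. T \<subseteq> B}" for B
    using that cl_least by blast
  ultimately have "\<Inter> {B \<in> {A \<inter> S |A. A \<in> flats M}. T \<subseteq> B} = cl M T \<inter> S"
    by (intro equalityI Inter_lower Inter_greatest)
  then show ?thesis using assms by (simp add: restriction_def cl_of_flats_def)
qed

lemma cl_contraction:
  assumes "S \<subseteq> ground M" "T \<subseteq> ground M - S"
  shows "cl (contraction M S) T = cl M (T \<union> S) - S"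
proof -
  have TS: "T \<union> S \<subseteq> ground M" using assms by blast
  then have "cl M (T \<union> S) - S \<in> {B \<in> {A - S |A. A \<in> flats M \<and> S \<subseteq> A}. T \<subseteq> B}"
    using assms cl_flat[OF TS] cl_increasing[OF TS] by blast
  moreover have "cl M (T \<union> S) - S \<subseteq> B"
    if "B \<in> {B \<in> {A - S |A. A \<in> flats M \<and> S \<subseteq> A}. T \<subseteq> B}" for B
  proof -
    from that obtain A where "A \<in> flats M" "S \<subseteq> A" "B = A - S" "T \<subseteq> A" by blast
    then show ?thesis using cl_least[of A "T \<union> S"] by blast
  qed
  ultimately have "\<Inter> {B \<in> {A - S |A. A \<in> flats M \<and> S \<subseteq> A}. T \<subseteq> B} = cl M (T \<union> S) - S"
    by (intro equalityI Inter_lower Inter_greatest)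
  then show ?thesis using assms by (simp add: contraction_def cl_of_flats_def)
qed

lemma flats_restriction:
  assumes "S \<subseteq> ground M"
  shows "flats (restriction M S) = {A \<inter> S |A. A \<in> flats M}"
proof
  show "flats (restriction M S) \<subseteq> {A \<inter> S |A. A \<in> flats M}"
  proof
    fix B assume "B \<in> flats (restriction M S)"
    then obtain T where "T \<subseteq> S" "B = cl (restriction M S) T"
      by (auto simp: flats_def restriction_def)
    then show "B \<in> {A \<inter> S |A. A \<in> flats M}"
      using cl_restriction[OF assms] cl_flat[of T] assms by blast
  qed
next
  show "{A \<inter> S |A. A \<in> flats M} \<subseteq> flats (restriction M S)"
  proof
    fix B assume "B \<in> {A \<inter> S |A. A \<in> flats M}"
    then obtain A where A: "A \<in> flats M" "B = A \<inter> S" by blast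
    have "B \<subseteq> cl M B" using A assms by (intro cl_increasing) blast
    moreover have "cl M B \<subseteq> A" using A cl_least by blast
    ultimately have "cl (restriction M S) B = B"
      using A cl_restriction[OF assms, of B] by blast
    moreover have "B \<in> Pow (ground (restriction M S))"
      using A by (simp add: restriction_def)
    ultimately show "B \<in> flats (restriction M S)"
      unfolding flats_def by (metis image_eqI)
  qed
qed

lemma flats_contraction:
  assumes "S \<subseteq> ground M"
  shows "flats (contraction M S) = {A - S |A. A \<in> flats M \<and> S \<subseteq> A}"
proof
  show "flats (contraction M S) \<subseteq> {A - S |A. A \<in> flats M \<and> S \<subseteq> A}"
  proof
    fix B assume "B \<in> flats (contraction M S)"
    then obtain T where T: "T \<subseteq> ground M - S" "B = cl (contraction M S) T"
      by (auto simp: flats_def contraction_def)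
    then have "T \<union> S \<subseteq> ground M" using assms by blast
    then show "B \<in> {A - S |A. A \<in> flats M \<and> S \<subseteq> A}"
      using cl_contraction[OF assms T(1)] T(2) cl_flat[of "T \<union> S"] cl_increasing[of "T \<union> S"]
      by (intro CollectI exI[of _ "cl M (T \<union> S)"]) simp
  qed
next
  show "{A - S |A. A \<in> flats M \<and> S \<subseteq> A} \<subseteq> flats (contraction M S)"
  proof
    fix B assume "B \<in> {A - S |A. A \<in> flats M \<and> S \<subseteq> A}"
    then obtain A where A: "A \<in> flats M" "S \<subseteq> A" "B = A - S" by blast
    then have "B \<union> S = A" by blast
    moreover have B: "B \<subseteq> ground M - S" using A flat_subset by blast
    ultimately have "cl (contraction M S) B = B"
      using A cl_contraction[OF assms, of B] flat_iff by simp
    moreover have "B \<in> Pow (ground (contraction M S))"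
      using B by (simp add: contraction_def)
    ultimately show "B \<in> flats (contraction M S)"
      unfolding flats_def by (metis image_eqI)
  qed
qed

end


section \<open>Pointed matroids and strong maps\<close>

record 'a pointed_matroid = "'a matroid" +
  pt :: 'a

locale pointed_matroid = matroid M for M (structure) +
  assumes pt_loop: "pt M \<in> cl M {}"

definition strong_map :: "'a pointed_matroid \<Rightarrow> 'a pointed_matroid \<Rightarrow> ('a \<Rightarrow> 'a) \<Rightarrow> bool" where
  "strong_map M N f \<longleftrightarrow> f \<in> ground M \<rightarrow>\<^sub>E ground N \<and> f (pt M) = pt N \<and>
     (\<forall>A \<in> flats N. f -` A \<inter> ground M \<in> flats M)"

record 'a mat_arrow =
  src :: "'a pointed_matroid"
  tgt :: "'a pointed_matroid"
  fn :: "'a \<Rightarrow> 'a"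

text \<open>
  The ground sets are the finite subsets of a type \<open>'a\<close>. If \<open>'a\<close> is infinite, then every pointed
  matroid is isomorphic to an object of this category.
\<close>

definition Mat :: "('a pointed_matroid, 'a mat_arrow) cat" where
  "Mat = \<lparr>
     Ob = {M. pointed_matroid M},
     Ar = {f. pointed_matroid (src f) \<and> pointed_matroid (tgt f) \<and>
              strong_map (src f) (tgt f) (fn f)},
     Dom = src,
     Cod = tgt,
     Idn = (\<lambda>M. \<lparr>src = M, tgt = M, fn = (\<lambda>x \<in> ground M. x)\<rparr>),
     Comp = (\<lambda>g f. \<lparr>src = src f, tgt = tgt g,
                     fn = compose (ground (src f)) (fn g) (fn f)\<rparr>)\<rparr>"

definition restriction_map :: "'a pointed_matroid \<Rightarrow> 'a set \<Rightarrow> 'a mat_arrow" where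
  "restriction_map M S = \<lparr>src = restriction M S, tgt = M, fn = (\<lambda>x \<in> S. x)\<rparr>"

definition contraction_map :: "'a pointed_matroid \<Rightarrow> 'a set \<Rightarrow> 'a mat_arrow" where
  "contraction_map M S = \<lparr>src = M, tgt = contraction M S,
     fn = (\<lambda>x \<in> ground M. if x \<in> S then pt M else x)\<rparr>"

definition mat_restrictions :: "'a mat_arrow set" where
  "mat_restrictions = {f \<in> Ar Mat. \<exists>S u. S \<subseteq> ground (tgt f) \<and> pt (tgt f) \<in> S \<and>
     u \<in> isomorphisms Mat \<and> u \<in> Hom Mat (src f) (restriction (tgt f) S) \<and>
     f = restriction_map (tgt f) S \<cdot>\<^bsub>Mat\<^esub> u}"

definition mat_contractions :: "'a mat_arrow set" where
  "mat_contractions = {f \<in> Ar Mat. \<exists>S u. S \<subseteq> ground (src f) \<and> pt (src f) \<notin> S \<and>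
     u \<in> isomorphisms Mat \<and> u \<in> Hom Mat (contraction (src f) S) (tgt f) \<and>
     f = u \<cdot>\<^bsub>Mat\<^esub> contraction_map (src f) S}"

end

(* Restrictions are the injective strong maps under which every flat is the preimage of a flat;
   contractions are the surjective strong maps that are injective away from the preimage of the
   point and under which every set with flat preimage is a flat. Strong maps therefore factor
   through restrictions and contractions as soon as the underlying functions do. In a commutative
   square with i, i' restrictions and j, j' contractions, being Cartesian and being co-Cartesian
   are both equivalent to the condition that the image of i contains the preimage of the point
   under j', and this condition guides the completion of spans and cospans. In an extension
   A \<rightarrow> B \<rightarrow> D the ground set of B is the wedge of those of A and D, so up to equivalence the
   extension is determined by the family of flats of B, viewed as subsets of the wedge. *)
theory Submission imports Defs begin

section \<open>Strong maps, restrictions and contractions\<close>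

text \<open>The point is a loop, so every flat contains it, and the preimage of a flat under a
  strong map contains the whole fibre over the point. Therefore taking preimages along a contraction
  by \<open>S\<close> automatically yields flats containing \<open>S\<close>, and these are all such
  flats. This is why \<open>embedding\<close> and \<open>quotient_map\<close> can describe the two
  classes without naming the set \<open>S\<close> or the isomorphism that the definitions ask for.
  Closure under composition then becomes formal, and universal properties reduce to statements about
  functions. Spans are completed by a contraction of the target of \<open>i\<close> and cospans by a
  restriction of the source of \<open>j'\<close>. Both live on subsets of a given ground set, so no
  new elements of the type are required. The kernel condition is extracted from a Cartesian square
  by testing it on the restriction to the kernel of \<open>j'\<close>, and from a co-Cartesian
  square by mapping it to the explicit completion of the span. The middle term of an extension may
  have any ground set of the right size, so there may be infinitely many extensions; only their
  classes can be counted, which calls for an invariant expressed in the two outer terms.\<close>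

lemma Mat_simps [simp]:
  "Ob Mat = {M. pointed_matroid M}"
  "Dom Mat = src" "Cod Mat = tgt"
  "Idn Mat M = \<lparr>src = M, tgt = M, fn = (\<lambda>x \<in> ground M. x)\<rparr>"
  "src (g \<cdot>\<^bsub>Mat\<^esub> f) = src f" "tgt (g \<cdot>\<^bsub>Mat\<^esub> f) = tgt g"
  "fn (g \<cdot>\<^bsub>Mat\<^esub> f) = compose (ground (src f)) (fn g) (fn f)"
  by (simp_all add: Mat_def)

lemma Ar_Mat:
  "f \<in> Ar Mat \<longleftrightarrow> pointed_matroid (src f) \<and> pointed_matroid (tgt f) \<and> strong_map (src f) (tgt f) (fn f)"
  by (simp add: Mat_def)

lemma Hom_Mat:
  "f \<in> Hom Mat M N \<longleftrightarrow> src f = M \<and> tgt f = N \<and>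
     pointed_matroid M \<and> pointed_matroid N \<and> strong_map M N (fn f)"
  by (auto simp: Hom_def Ar_Mat)

text \<open>The functions of arrows are extensional on the ground set of the source, so pointwise
  agreement there is enough.\<close>

lemma arrow_eqI:
  assumes "f \<in> Hom Mat M N" "g \<in> Hom Mat M N" "\<And>x. x \<in> ground M \<Longrightarrow> fn f x = fn g x"
  shows "f = g"
proof -
  have "fn f = fn g"
    using assms by (intro extensionalityI[of _ "ground M"]) (auto simp: Hom_Mat strong_map_def PiE_def)
  then show ?thesis using assms by (simp add: Hom_Mat)
qed

lemma strong_map_restrictI:
  assumes "pt M \<in> ground M" "f (pt M) = pt N" "\<And>x. x \<in> ground M \<Longrightarrow> f x \<in> ground N"
    and "\<And>A. A \<in> flats N \<Longrightarrow> {x \<in> ground M. f x \<in> A} \<in> flats M"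
  shows "strong_map M N (restrict f (ground M))"
proof -
  have "restrict f (ground M) -` A \<inter> ground M = {x \<in> ground M. f x \<in> A}" for A by auto
  then show ?thesis using assms by (simp add: strong_map_def)
qed

lemma strong_map_app: "strong_map M N f \<Longrightarrow> x \<in> ground M \<Longrightarrow> f x \<in> ground N"
  by (auto simp: strong_map_def)

lemma strong_map_pt: "strong_map M N f \<Longrightarrow> f (pt M) = pt N"
  by (auto simp: strong_map_def)

lemma strong_map_flat: "strong_map M N f \<Longrightarrow> A \<in> flats N \<Longrightarrow> {x \<in> ground M. f x \<in> A} \<in> flats M"
  by (auto simp: strong_map_def vimage_def Int_def conj_commute)

context pointed_matroid
begin

text \<open>A flat contains the closure of the empty set, hence every loop. Nearly every flatness
  argument below relies on this.\<close>

lemma pt_flat: "A \<in> flats M \<Longrightarrow> pt M \<in> A"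
  using pt_loop cl_least[of A "{}"] by auto

lemma ground_flat: "ground M \<in> flats M"
  using cl_increasing[OF order_refl] flat_subset[OF cl_flat[OF order_refl]] flat_iff by blast

lemma pt_ground: "pt M \<in> ground M"
  using pt_flat ground_flat by blast

end

section \<open>Restrictions and contractions are again pointed matroids\<close>

lemma ground_restriction [simp]: "ground (restriction M S) = S"
  and pt_restriction [simp]: "pt (restriction P S) = pt P"
  and ground_contraction [simp]: "ground (contraction M S) = ground M - S"
  and pt_contraction [simp]: "pt (contraction P S) = pt P"
  by (simp_all add: restriction_def contraction_def)

lemma pointed_matroid_restriction:
  assumes M: "pointed_matroid M" and S: "S \<subseteq> ground M" and p: "pt M \<in> S"
  shows "pointed_matroid (restriction M S)"
proof -
  interpret pointed_matroid M by fact
  note c = cl_restriction[OF S]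
  have sub: "T \<subseteq> S \<Longrightarrow> T \<subseteq> ground M" for T using S by blast
  show ?thesis
  proof (unfold_locales; simp)
    show "finite S" using finite_ground S finite_subset by blast
    have "cl (restriction M S) \<in> extensional (Pow S)"
      by (simp add: restriction_def cl_of_flats_def)
    then show "cl (restriction M S) \<in> Pow S \<rightarrow>\<^sub>E Pow S" using c by (auto simp: PiE_iff)
  next
    fix T assume T: "T \<subseteq> S"
    show "T \<subseteq> cl (restriction M S) T" using T c[OF T] cl_increasing[OF sub[OF T]] by blast
    \<comment> \<open>Idempotence: \<open>cl M (cl M T \<inter> S)\<close> contains
      \<open>cl M T \<inter> S\<close> and is contained in \<open>cl M T\<close>, so its trace on
      \<open>S\<close> is again \<open>cl M T \<inter> S\<close>.\<close>
    have 1: "cl M T \<inter> S \<subseteq> cl M T" by blast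
    have 2: "cl M T \<subseteq> ground M" using cl_flat[OF sub[OF T]] flat_subset by blast
    have "cl M (cl M T \<inter> S) \<subseteq> cl M T" using cl_mono[OF 1 2] cl_idem[OF sub[OF T]] by simp
    moreover have "cl M T \<inter> S \<subseteq> cl M (cl M T \<inter> S)" using 2 by (intro cl_increasing) blast
    ultimately show "cl (restriction M S) (cl (restriction M S) T) = cl (restriction M S) T"
      using c[OF T] c[of "cl M T \<inter> S"] by auto
  next
    fix T U assume "T \<subseteq> U" "U \<subseteq> S"
    then show "cl (restriction M S) T \<subseteq> cl (restriction M S) U"
      using c[of T] c[of U] cl_mono[of T U] sub by auto
  next
    fix T x y assume A: "T \<subseteq> S" "x \<in> S"
      "y \<in> cl (restriction M S) (insert x T) \<and> y \<notin> cl (restriction M S) T"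
    then have y: "y \<in> S" using c[of "insert x T"] by auto
    have "y \<in> cl M (T \<union> {x}) - cl M T" using A y c[of "insert x T"] c[of T] by auto
    then have "x \<in> cl M (T \<union> {y})" using cl_exchange[of T x y] A(1,2) S by auto
    then show "x \<in> cl (restriction M S) (insert y T)" using c[of "insert y T"] A(1,2) y by auto
  next
    show "pt M \<in> cl (restriction M S) {}" using c[of "{}"] p pt_loop by auto
  qed
qed

text \<open>The closure of \<open>T\<close> in the contraction is the closure of
  \<open>T \<union> S\<close> in \<open>M\<close> with \<open>S\<close> removed, so each axiom is
  the axiom of \<open>M\<close> applied to sets enlarged by \<open>S\<close>.\<close>

lemma pointed_matroid_contraction:
  assumes M: "pointed_matroid M" and S: "S \<subseteq> ground M" and p: "pt M \<notin> S"
  shows "pointed_matroid (contraction M S)"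
proof -
  interpret pointed_matroid M by fact
  note c = cl_contraction[OF S]
  have sub: "T \<subseteq> ground M - S \<Longrightarrow> T \<union> S \<subseteq> ground M" for T using S by blast
  show ?thesis
  proof (unfold_locales; simp)
    show "finite (ground M - S)" using finite_ground by blast
    have "cl (contraction M S) \<in> extensional (Pow (ground M - S))"
      by (simp add: contraction_def cl_of_flats_def)
    moreover have "T \<subseteq> ground M - S \<Longrightarrow> cl M (T \<union> S) \<subseteq> ground M" for T
      using cl_flat[OF sub] flat_subset by blast
    ultimately show "cl (contraction M S) \<in> Pow (ground M - S) \<rightarrow>\<^sub>E Pow (ground M - S)"
      using c by (auto simp: PiE_iff)
  next
    fix T assume T: "T \<subseteq> ground M - S"
    have 1: "T \<union> S \<subseteq> cl M (T \<union> S)" using cl_increasing[OF sub[OF T]] .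
    show "T \<subseteq> cl (contraction M S) T" using T c[OF T] 1 by blast
    have "cl M (T \<union> S) \<subseteq> ground M" using cl_flat[OF sub[OF T]] flat_subset by blast
    \<comment> \<open>Removing \<open>S\<close> and putting it back changes nothing because the
      closure already contains \<open>S\<close>; this reduces idempotence to that of
      \<open>cl M\<close>.\<close>
    moreover have "cl M (T \<union> S) - S \<union> S = cl M (T \<union> S)" using 1 by blast
    ultimately show "cl (contraction M S) (cl (contraction M S) T) = cl (contraction M S) T"
      using c[OF T] c[of "cl M (T \<union> S) - S"] cl_idem[OF sub[OF T]] by auto
  next
    fix T U assume "T \<subseteq> U" "U \<subseteq> ground M - S"
    then show "cl (contraction M S) T \<subseteq> cl (contraction M S) U"
      using c[of T] c[of U] cl_mono[of "T \<union> S" "U \<union> S"] sub[of U] by auto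
  next
    fix T x y assume A: "T \<subseteq> ground M - S" "x \<in> ground M \<and> x \<notin> S"
      "y \<in> cl (contraction M S) (insert x T) \<and> y \<notin> cl (contraction M S) T"
    have xT: "insert x T \<subseteq> ground M - S" using A by auto
    have y1: "y \<in> cl M (insert x T \<union> S) - S" using A(3) c[OF xT] by auto
    then have y: "y \<in> ground M - S" using cl_flat[OF sub[OF xT]] flat_subset by blast
    have "y \<in> cl M (T \<union> S \<union> {x}) - cl M (T \<union> S)" using A y1 c[of T] by auto
    then have "x \<in> cl M (T \<union> S \<union> {y})" using cl_exchange[of "T \<union> S" x y] A(2) sub[OF A(1)] by auto
    then show "x \<in> cl (contraction M S) (insert y T)" using c[of "insert y T"] A(1,2) y by auto
  next
    \<comment> \<open>The closure of the empty set becomes \<open>cl M S - S\<close>; the point lies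
      in the flat \<open>cl M S\<close> and outside \<open>S\<close>.\<close>
    show "pt M \<in> cl (contraction M S) {}"
      using c[of "{}"] p pt_flat[OF cl_flat[OF S]] by auto
  qed
qed

section \<open>The category of pointed matroids\<close>

lemma strong_map_comp:
  assumes "pointed_matroid A" "strong_map A B f" "strong_map B D g"
  shows "strong_map A D (compose (ground A) g f)"
proof -
  interpret A: pointed_matroid A by fact
  note f = assms(2) and g = assms(3)
  show ?thesis unfolding compose_def
  proof (rule strong_map_restrictI)
    fix F assume "F \<in> flats D"
    from strong_map_flat[OF f strong_map_flat[OF g this]] strong_map_app[OF f]
    show "{x \<in> ground A. g (f x) \<in> F} \<in> flats A" by (simp cong: conj_cong)
  qed (use strong_map_pt[OF f] strong_map_pt[OF g] strong_map_app[OF f] strong_map_app[OF g] A.pt_ground in auto)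
qed

lemma category_Mat: "category (Mat :: ('a pointed_matroid, 'a mat_arrow) cat)"
proof
  fix f g h :: "'a mat_arrow" and A B D E :: "'a pointed_matroid"
  show "f \<in> Ar Mat \<Longrightarrow> Dom Mat f \<in> Ob Mat" "f \<in> Ar Mat \<Longrightarrow> Cod Mat f \<in> Ob Mat"
    by (simp_all add: Ar_Mat)
  have I: "Idn Mat A \<in> Hom Mat A A" if "pointed_matroid A" for A :: "'a pointed_matroid"
  proof -
    interpret pointed_matroid A by fact
    have "{x \<in> ground A. x \<in> F} = F" if "F \<in> flats A" for F using flat_subset that by blast
    then show ?thesis using that pt_ground by (auto simp: Hom_Mat intro!: strong_map_restrictI)
  qed
  then show "A \<in> Ob Mat \<Longrightarrow> Idn Mat A \<in> Hom Mat A A" by simp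
  have C: "g \<cdot>\<^bsub>Mat\<^esub> f \<in> Hom Mat A D" if "f \<in> Hom Mat A B" "g \<in> Hom Mat B D"
    for f g and A B D :: "'a pointed_matroid"
    using that strong_map_comp by (auto simp: Hom_Mat)
  then show "f \<in> Hom Mat A B \<Longrightarrow> g \<in> Hom Mat B D \<Longrightarrow> g \<cdot>\<^bsub>Mat\<^esub> f \<in> Hom Mat A D" .
  { assume f: "f \<in> Hom Mat A B"
    have AB: "pointed_matroid A" "pointed_matroid B" using f by (auto simp: Hom_Mat)
    have "fn f x \<in> ground B" if "x \<in> ground A" for x
      using f that by (auto simp: Hom_Mat strong_map_app)
    then show "f \<cdot>\<^bsub>Mat\<^esub> Idn Mat A = f" "Idn Mat B \<cdot>\<^bsub>Mat\<^esub> f = f"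
      using f by (intro arrow_eqI[OF C[OF I f] f, OF AB(1)] arrow_eqI[OF C[OF f I] f, OF AB(2)];
        simp add: Hom_Mat compose_def)+
    assume g: "g \<in> Hom Mat B D" and h: "h \<in> Hom Mat D E"
    have "fn f x \<in> ground B" if "x \<in> ground A" for x
      using f that by (auto simp: Hom_Mat strong_map_app)
    then show "h \<cdot>\<^bsub>Mat\<^esub> (g \<cdot>\<^bsub>Mat\<^esub> f) = h \<cdot>\<^bsub>Mat\<^esub> g \<cdot>\<^bsub>Mat\<^esub> f"
      using f g by (intro arrow_eqI[OF C[OF C[OF f g] h] C[OF f C[OF g h]]])
        (simp add: Hom_Mat compose_def) }
qed

interpretation Mat: category Mat by (rule category_Mat)

section \<open>Intrinsic description of restrictions and contractions\<close>

text \<open>Together with strongness, the last clause says that the flats of \<open>M\<close> are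
  exactly the preimages of flats of \<open>N\<close>: the matroid structure of \<open>M\<close> is
  induced from \<open>N\<close>.\<close>

definition embedding :: "'a pointed_matroid \<Rightarrow> 'a pointed_matroid \<Rightarrow> ('a \<Rightarrow> 'a) \<Rightarrow> bool" where
  "embedding M N f \<longleftrightarrow> strong_map M N f \<and> inj_on f (ground M) \<and>
     (\<forall>F \<in> flats M. \<exists>G \<in> flats N. F = {x \<in> ground M. f x \<in> G})"

text \<open>Dual to \<open>embedding\<close>: a subset of \<open>N\<close> is a flat exactly when
  its preimage is one. Collapsing is allowed only onto the point, so a fibre over any other element
  is a singleton.\<close>

definition quotient_map :: "'a pointed_matroid \<Rightarrow> 'a pointed_matroid \<Rightarrow> ('a \<Rightarrow> 'a) \<Rightarrow> bool" where
  "quotient_map M N f \<longleftrightarrow> strong_map M N f \<and> f ` ground M = ground N \<and>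
     (\<forall>x \<in> ground M. \<forall>y \<in> ground M. f x = f y \<longrightarrow> x = y \<or> f x = pt N) \<and>
     (\<forall>F. F \<subseteq> ground N \<longrightarrow> {x \<in> ground M. f x \<in> F} \<in> flats M \<longrightarrow> F \<in> flats N)"

lemma quotient_map_surj: "quotient_map M N f \<Longrightarrow> y \<in> ground N \<Longrightarrow> \<exists>x \<in> ground M. y = f x"
  unfolding quotient_map_def by blast

lemma quotient_map_fibre:
  "quotient_map M N f \<Longrightarrow> x \<in> ground M \<Longrightarrow> y \<in> ground M \<Longrightarrow> f x = f y \<Longrightarrow> x = y \<or> f x = pt N"
  unfolding quotient_map_def by blast

lemma quotient_map_flat:
  "quotient_map M N f \<Longrightarrow> F \<subseteq> ground N \<Longrightarrow> {x \<in> ground M. f x \<in> F} \<in> flats M \<Longrightarrow> F \<in> flats N"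
  unfolding quotient_map_def by blast

lemma embedding_comp:
  assumes A: "pointed_matroid A" and f: "embedding A B f" and g: "embedding B D g"
  shows "embedding A D (compose (ground A) g f)"
  unfolding embedding_def
proof (intro conjI ballI)
  have app: "x \<in> ground A \<Longrightarrow> f x \<in> ground B" for x
    using f strong_map_app by (auto simp: embedding_def)
  show "strong_map A D (compose (ground A) g f)"
    using assms strong_map_comp by (auto simp: embedding_def)
  show "inj_on (compose (ground A) g f) (ground A)"
    using f g app by (auto simp: embedding_def inj_on_def compose_def)
  fix F assume "F \<in> flats A"
  then obtain G where G: "G \<in> flats B" "F = {x \<in> ground A. f x \<in> G}"
    using f by (auto simp: embedding_def)
  then obtain H where "H \<in> flats D" "G = {x \<in> ground B. g x \<in> H}"
    using g by (auto simp: embedding_def)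
  then show "\<exists>H \<in> flats D. F = {x \<in> ground A. compose (ground A) g f x \<in> H}"
    using G app by (intro bexI[of _ H]) (auto simp: compose_def)
qed

lemma quotient_map_comp:
  assumes A: "pointed_matroid A" and f: "quotient_map A B f" and g: "quotient_map B D g"
  shows "quotient_map A D (compose (ground A) g f)"
  unfolding quotient_map_def
proof (intro conjI ballI allI impI)
  have f': "strong_map A B f" and g': "strong_map B D g" using f g by (auto simp: quotient_map_def)
  show "strong_map A D (compose (ground A) g f)" using strong_map_comp A f' g' .
  show "compose (ground A) g f ` ground A = ground D"
  proof -
    have "compose (ground A) g f ` ground A = g ` f ` ground A"
      by (auto simp: compose_def)
    then show ?thesis using f g by (simp add: quotient_map_def)
  qed
  { fix x y assume xy: "x \<in> ground A" "y \<in> ground A"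
      and eq: "compose (ground A) g f x = compose (ground A) g f y"
    have "f x = f y \<or> g (f x) = pt D"
      using eq xy g strong_map_app[OF f'] by (auto simp: quotient_map_def compose_def)
    moreover have "f x = f y \<Longrightarrow> x = y \<or> f x = pt B"
      using xy f by (auto simp: quotient_map_def)
    ultimately show "x = y \<or> compose (ground A) g f x = pt D"
      using xy strong_map_pt[OF g'] by (auto simp: compose_def) }
  fix F assume F: "F \<subseteq> ground D" "{x \<in> ground A. compose (ground A) g f x \<in> F} \<in> flats A"
  have "{x \<in> ground A. compose (ground A) g f x \<in> F} = {x \<in> ground A. f x \<in> {y \<in> ground B. g y \<in> F}}"
    using strong_map_app[OF f'] by (auto simp: compose_def)
  then have "{y \<in> ground B. g y \<in> F} \<in> flats B"
    using F(2) by (intro quotient_map_flat[OF f]) auto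
  then show "F \<in> flats D" using F g by (auto simp: quotient_map_def)
qed

lemma embedding_restriction_map:
  assumes M: "pointed_matroid M" and S: "S \<subseteq> ground M" "pt M \<in> S"
  shows "embedding (restriction M S) M (\<lambda>x \<in> S. x)"
proof -
  interpret pointed_matroid M by fact
  show ?thesis unfolding embedding_def
  proof (intro conjI ballI)
    have "strong_map (restriction M S) M (restrict (\<lambda>x. x) (ground (restriction M S)))"
      using S by (intro strong_map_restrictI) (auto simp: flats_restriction)
    then show "strong_map (restriction M S) M (\<lambda>x \<in> S. x)" by simp
    fix F assume "F \<in> flats (restriction M S)"
    then show "\<exists>G \<in> flats M. F = {x \<in> ground (restriction M S). (\<lambda>x \<in> S. x) x \<in> G}"
      using S by (auto simp: flats_restriction)
  qed (auto simp: inj_on_def)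
qed

text \<open>A set \<open>F\<close> avoiding \<open>S\<close> and containing the point has preimage
  \<open>F \<union> S\<close>, and \<open>F \<mapsto> F \<union> S\<close> matches the flats of the
  contraction with the flats of \<open>M\<close> containing \<open>S\<close>.\<close>

lemma quotient_map_contraction_map:
  assumes M: "pointed_matroid M" and S: "S \<subseteq> ground M" "pt M \<notin> S"
  shows "quotient_map M (contraction M S) (\<lambda>x \<in> ground M. if x \<in> S then pt M else x)"
    (is "quotient_map M ?N ?f")
proof -
  interpret pointed_matroid M by fact
  have pre: "{x \<in> ground M. (if x \<in> S then pt M else x) \<in> F} = F \<union> S"
    if "F \<subseteq> ground M - S" "pt M \<in> F" for F using that S by auto
  show ?thesis unfolding quotient_map_def
  proof (intro conjI ballI allI impI)
    show "strong_map M ?N ?f"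
    proof (rule strong_map_restrictI)
      fix F assume "F \<in> flats ?N"
      moreover from this obtain A where A: "A \<in> flats M" "S \<subseteq> A" "F = A - S"
        using S by (auto simp: flats_contraction)
      moreover have "F \<union> S = A" using A by auto
      moreover have "pt M \<in> F" "F \<subseteq> ground M - S" using A S pt_flat[OF A(1)] flat_subset[OF A(1)] by auto
      ultimately show "{x \<in> ground M. (if x \<in> S then pt M else x) \<in> F} \<in> flats M"
        using pre[of F] by simp
    qed (use S pt_ground in auto)
    show "?f ` ground M = ground ?N" using S pt_ground by auto
    fix F assume F: "F \<subseteq> ground ?N" "{x \<in> ground M. ?f x \<in> F} \<in> flats M"
    \<comment> \<open>The formula \<open>pre\<close> applies only to sets containing the point. Here
      the point lies in the preimage because that is a flat, and it is its own image.\<close>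
    then have "pt M \<in> {x \<in> ground M. ?f x \<in> F}" using pt_flat by blast
    then have p: "pt M \<in> F" using S by (auto split: if_splits)
    have "{x \<in> ground M. ?f x \<in> F} = F \<union> S" using pre[OF _ p] F by (auto split: if_splits)
    then show "F \<in> flats ?N" using F S by (auto simp: flats_contraction intro!: exI[of _ "F \<union> S"])
  qed (auto split: if_splits)
qed

section \<open>Isomorphisms\<close>

text \<open>A bijective strong map need not be invertible in the category. The inverse function
  pulls flats back to their images under \<open>f\<close>, so images of flats being flats is what
  makes it strong.\<close>

lemma isomorphismI:
  assumes f: "f \<in> Hom Mat A B" and bij: "bij_betw (fn f) (ground A) (ground B)"
    and im: "\<And>F. F \<in> flats A \<Longrightarrow> fn f ` F \<in> flats B"
  shows "f \<in> isomorphisms Mat"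
proof -
  interpret A: pointed_matroid A using f by (simp add: Hom_Mat)
  interpret B: pointed_matroid B using f by (simp add: Hom_Mat)
  define g where "g = \<lparr>src = B, tgt = A, fn = restrict (inv_into (ground A) (fn f)) (ground B)\<rparr>"
  have inj: "inj_on (fn f) (ground A)" and surj: "fn f ` ground A = ground B"
    using bij by (auto simp: bij_betw_def)
  have fi: "fn f (inv_into (ground A) (fn f) y) = y" if "y \<in> ground B" for y
    using that surj by (simp add: f_inv_into_f)
  have if': "inv_into (ground A) (fn f) (fn f x) = x" if "x \<in> ground A" for x
    using that inj by simp
  have mem: "inv_into (ground A) (fn f) y \<in> ground A" if "y \<in> ground B" for y
    using that surj by (simp add: inv_into_into)
  have fpt: "fn f (pt A) = pt B" and app: "x \<in> ground A \<Longrightarrow> fn f x \<in> ground B" for x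
    using f strong_map_pt strong_map_app by (auto simp: Hom_Mat)
  have "strong_map B A (restrict (inv_into (ground A) (fn f)) (ground B))"
  proof (rule strong_map_restrictI)
    show "inv_into (ground A) (fn f) (pt B) = pt A" using if'[OF A.pt_ground] fpt by simp
    fix F assume F: "F \<in> flats A"
    then have "F \<subseteq> ground A" by (rule A.flat_subset)
    then have "{y \<in> ground B. inv_into (ground A) (fn f) y \<in> F} = fn f ` F"
      using fi if' mem app by (force simp: image_iff)
    then show "{y \<in> ground B. inv_into (ground A) (fn f) y \<in> F} \<in> flats B" using im[OF F] by simp
  qed (use B.pt_ground mem in auto)
  then have g: "g \<in> Hom Mat B A" using f by (simp add: Hom_Mat g_def)
  have "g \<cdot>\<^bsub>Mat\<^esub> f = Idn Mat A"
    using f if' app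
    by (intro arrow_eqI[OF Mat.Comp_in_Hom[OF f g] Mat.Idn_in_Hom])
      (auto simp: Hom_Mat g_def compose_def)
  moreover have "f \<cdot>\<^bsub>Mat\<^esub> g = Idn Mat B"
    using f fi
    by (intro arrow_eqI[OF Mat.Comp_in_Hom[OF g f] Mat.Idn_in_Hom])
      (auto simp: Hom_Mat g_def compose_def)
  ultimately show ?thesis using f g by (auto simp: isomorphisms_def Hom_def)
qed

lemma isomorphismE:
  assumes "f \<in> isomorphisms Mat" "f \<in> Hom Mat A B"
  shows "bij_betw (fn f) (ground A) (ground B)" "F \<in> flats A \<Longrightarrow> fn f ` F \<in> flats B"
proof -
  obtain g where g: "g \<in> Hom Mat B A" and gf: "g \<cdot>\<^bsub>Mat\<^esub> f = Idn Mat A" and fg: "f \<cdot>\<^bsub>Mat\<^esub> g = Idn Mat B"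
    using assms by (auto simp: isomorphisms_def Hom_def)
  have 1: "fn g (fn f x) = x" if "x \<in> ground A" for x
    using arg_cong[OF gf, of "\<lambda>h. fn h x"] that assms(2) by (simp add: compose_def Hom_Mat)
  have 2: "fn f (fn g y) = y" if "y \<in> ground B" for y
    using arg_cong[OF fg, of "\<lambda>h. fn h y"] that g by (simp add: compose_def Hom_Mat)
  have f: "strong_map A B (fn f)" and g': "strong_map B A (fn g)"
    using assms(2) g by (auto simp: Hom_Mat)
  show "bij_betw (fn f) (ground A) (ground B)"
    using 1 2 strong_map_app[OF f] strong_map_app[OF g'] by (auto intro!: bij_betw_byWitness[of _ "fn g"])
  assume F: "F \<in> flats A"
  then have "F \<subseteq> ground A" using assms(2) by (auto simp: Hom_Mat pointed_matroid_def dest: matroid.flat_subset)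
  then have "{y \<in> ground B. fn g y \<in> F} = fn f ` F"
    using 1 2 strong_map_app[OF f] by (force simp: image_iff)
  then show "fn f ` F \<in> flats B" using strong_map_flat[OF g' F] by simp
qed

lemma isomorphism_embedding:
  assumes "f \<in> isomorphisms Mat" "f \<in> Hom Mat A B"
  shows "embedding A B (fn f)"
  unfolding embedding_def
proof (intro conjI ballI)
  show "strong_map A B (fn f)" using assms(2) by (simp add: Hom_Mat)
  show inj: "inj_on (fn f) (ground A)" using isomorphismE(1)[OF assms] by (simp add: bij_betw_def)
  fix F assume F: "F \<in> flats A"
  then have "F \<subseteq> ground A" using assms(2) by (auto simp: Hom_Mat pointed_matroid_def dest: matroid.flat_subset)
  then have "F = {x \<in> ground A. fn f x \<in> fn f ` F}" using inj by (auto simp: inj_on_def)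
  then show "\<exists>G \<in> flats B. F = {x \<in> ground A. fn f x \<in> G}" using isomorphismE(2)[OF assms F] by blast
qed

lemma isomorphism_quotient_map:
  assumes "f \<in> isomorphisms Mat" "f \<in> Hom Mat A B"
  shows "quotient_map A B (fn f)"
  unfolding quotient_map_def
proof (intro conjI ballI allI impI)
  show "strong_map A B (fn f)" using assms(2) by (simp add: Hom_Mat)
  show surj: "fn f ` ground A = ground B"
    using isomorphismE(1)[OF assms] by (simp add: bij_betw_def)
  fix x y assume "x \<in> ground A" "y \<in> ground A" "fn f x = fn f y"
  then show "x = y \<or> fn f x = pt B"
    using isomorphismE(1)[OF assms] by (auto simp: bij_betw_def inj_on_def)
next
  fix F assume F: "F \<subseteq> ground B" "{x \<in> ground A. fn f x \<in> F} \<in> flats A"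
  have "fn f ` {x \<in> ground A. fn f x \<in> F} = F"
    using F(1) isomorphismE(1)[OF assms] by (auto simp: bij_betw_def)
  then show "F \<in> flats B" using isomorphismE(2)[OF assms F(2)] by simp
qed

text \<open>By surjectivity the image of the preimage of \<open>G\<close> is \<open>G\<close>
  itself, so images of flats are flats.\<close>

lemma surj_embedding_isomorphism:
  assumes "f \<in> Hom Mat A B" "embedding A B (fn f)" "fn f ` ground A = ground B"
  shows "f \<in> isomorphisms Mat"
proof (rule isomorphismI[OF assms(1)])
  show "bij_betw (fn f) (ground A) (ground B)" using assms by (simp add: bij_betw_def embedding_def)
  fix F assume "F \<in> flats A"
  then obtain G where G: "G \<in> flats B" "F = {x \<in> ground A. fn f x \<in> G}"
    using assms by (auto simp: embedding_def)
  have "G \<subseteq> fn f ` ground A"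
    using G assms by (auto simp: Hom_Mat pointed_matroid_def dest: matroid.flat_subset)
  then have "fn f ` F = G" using G by auto
  then show "fn f ` F \<in> flats B" using G by simp
qed

text \<open>By injectivity a flat is the preimage of its own image, so the image is a flat by the
  last clause of \<open>quotient_map\<close>.\<close>

lemma inj_quotient_map_isomorphism:
  assumes "f \<in> Hom Mat A B" "quotient_map A B (fn f)" "inj_on (fn f) (ground A)"
  shows "f \<in> isomorphisms Mat"
proof (rule isomorphismI[OF assms(1)])
  show "bij_betw (fn f) (ground A) (ground B)" using assms by (simp add: bij_betw_def quotient_map_def)
  fix F assume F: "F \<in> flats A"
  then have sub: "F \<subseteq> ground A"
    using assms by (auto simp: Hom_Mat pointed_matroid_def dest: matroid.flat_subset)
  then have "{x \<in> ground A. fn f x \<in> fn f ` F} = F" using assms(3) by (auto simp: inj_on_def)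
  moreover have "fn f ` F \<subseteq> ground B" using sub assms(2) by (auto simp: quotient_map_def)
  ultimately show "fn f ` F \<in> flats B" using assms(2) F by (simp add: quotient_map_def)
qed

section \<open>The admissible classes are the embeddings and the quotient maps\<close>

text \<open>One direction is composition of an isomorphism with an inclusion. Conversely,
  \<open>S\<close> has to be the image of \<open>f\<close>, and corestricting \<open>f\<close> to
  its image gives a surjective embedding, hence an isomorphism.\<close>

lemma mat_restrictions_iff:
  "f \<in> mat_restrictions \<longleftrightarrow>
     pointed_matroid (src f) \<and> pointed_matroid (tgt f) \<and> embedding (src f) (tgt f) (fn f)"
proof (intro iffI conjI; (elim conjE)?)
  assume f: "f \<in> mat_restrictions"
  then show 1: "pointed_matroid (src f)" and 2: "pointed_matroid (tgt f)"
    by (auto simp: mat_restrictions_def Ar_Mat)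
  from f obtain S u where S: "S \<subseteq> ground (tgt f)" "pt (tgt f) \<in> S"
    and u: "u \<in> isomorphisms Mat" "u \<in> Hom Mat (src f) (restriction (tgt f) S)"
    and eq: "f = restriction_map (tgt f) S \<cdot>\<^bsub>Mat\<^esub> u"
    by (auto simp: mat_restrictions_def)
  have "embedding (src f) (tgt f) (compose (ground (src f)) (\<lambda>x \<in> S. x) (fn u))"
    using embedding_comp[OF 1 isomorphism_embedding[OF u] embedding_restriction_map[OF 2 S]] .
  then show "embedding (src f) (tgt f) (fn f)"
    using arg_cong[OF eq, of fn] u by (simp add: restriction_map_def Hom_Mat)
next
  assume A: "pointed_matroid (src f)" and B: "pointed_matroid (tgt f)"
    and e: "embedding (src f) (tgt f) (fn f)"
  interpret A: pointed_matroid "src f" by fact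
  interpret B: pointed_matroid "tgt f" by fact
  have f: "strong_map (src f) (tgt f) (fn f)" using e by (simp add: embedding_def)
  define S where "S = fn f ` ground (src f)"
  have S: "S \<subseteq> ground (tgt f)" "pt (tgt f) \<in> S"
    using strong_map_app[OF f] strong_map_pt[OF f] A.pt_ground by (auto simp: S_def image_iff) metis
  define u where "u = \<lparr>src = src f, tgt = restriction (tgt f) S, fn = fn f\<rparr>"
  \<comment> \<open>The flats of the restriction are the sets \<open>G \<inter> S\<close>; since all
    values of \<open>f\<close> lie in \<open>S\<close>, such a set has the same preimage as
    \<open>G\<close>.\<close>
  have pre: "{x \<in> ground (src f). fn f x \<in> G \<inter> S} = {x \<in> ground (src f). fn f x \<in> G}" for G
    by (auto simp: S_def)
  have "strong_map (src f) (restriction (tgt f) S) (restrict (fn f) (ground (src f)))"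
  proof (rule strong_map_restrictI)
    fix F assume "F \<in> flats (restriction (tgt f) S)"
    then show "{x \<in> ground (src f). fn f x \<in> F} \<in> flats (src f)"
      using pre strong_map_flat[OF f] by (auto simp: B.flats_restriction[OF S(1)])
  qed (use A.pt_ground strong_map_pt[OF f] in \<open>auto simp: S_def\<close>)
  moreover have "restrict (fn f) (ground (src f)) = fn f"
    using f by (auto simp: strong_map_def PiE_def extensional_restrict)
  ultimately have su: "strong_map (src f) (restriction (tgt f) S) (fn f)" by simp
  then have u: "u \<in> Hom Mat (src f) (restriction (tgt f) S)"
    using A pointed_matroid_restriction[OF B S] by (simp add: Hom_Mat u_def)
  have "embedding (src f) (restriction (tgt f) S) (fn f)"
    unfolding embedding_def
  proof (intro conjI ballI)
    fix F assume "F \<in> flats (src f)"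
    then obtain G where "G \<in> flats (tgt f)" "F = {x \<in> ground (src f). fn f x \<in> G}"
      using e by (auto simp: embedding_def)
    then show "\<exists>G \<in> flats (restriction (tgt f) S). F = {x \<in> ground (src f). fn f x \<in> G}"
      using pre by (intro bexI[of _ "G \<inter> S"]) (auto simp: B.flats_restriction[OF S(1)])
  qed (use su e in \<open>auto simp: embedding_def\<close>)
  then have "u \<in> isomorphisms Mat"
    by (intro surj_embedding_isomorphism[OF u]) (auto simp: u_def S_def)
  moreover have "f = restriction_map (tgt f) S \<cdot>\<^bsub>Mat\<^esub> u"
  proof (rule arrow_eqI)
    show "f \<in> Hom Mat (src f) (tgt f)" using A B f by (simp add: Hom_Mat)
    show "restriction_map (tgt f) S \<cdot>\<^bsub>Mat\<^esub> u \<in> Hom Mat (src f) (tgt f)"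
      using embedding_restriction_map[OF B S] pointed_matroid_restriction[OF B S] B
      by (intro Mat.Comp_in_Hom[OF u]) (simp add: Hom_Mat restriction_map_def embedding_def)
  qed (auto simp: u_def restriction_map_def compose_def S_def)
  moreover have "f \<in> Ar Mat" using A B f by (simp add: Ar_Mat)
  ultimately show "f \<in> mat_restrictions" using S u unfolding mat_restrictions_def by blast
qed

text \<open>Conversely, the set to contract is the fibre over the point with the point of the source
  taken out. On the remaining elements \<open>f\<close> is injective, and it stays surjective
  because the point represents all of \<open>S\<close>.\<close>

lemma mat_contractions_iff:
  "f \<in> mat_contractions \<longleftrightarrow>
     pointed_matroid (src f) \<and> pointed_matroid (tgt f) \<and> quotient_map (src f) (tgt f) (fn f)"
proof (intro iffI conjI; (elim conjE)?)
  assume f: "f \<in> mat_contractions"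
  then show 1: "pointed_matroid (src f)" and 2: "pointed_matroid (tgt f)"
    by (auto simp: mat_contractions_def Ar_Mat)
  from f obtain S u where S: "S \<subseteq> ground (src f)" "pt (src f) \<notin> S"
    and u: "u \<in> isomorphisms Mat" "u \<in> Hom Mat (contraction (src f) S) (tgt f)"
    and eq: "f = u \<cdot>\<^bsub>Mat\<^esub> contraction_map (src f) S"
    by (auto simp: mat_contractions_def)
  show "quotient_map (src f) (tgt f) (fn f)"
    using quotient_map_comp[OF 1 quotient_map_contraction_map[OF 1 S] isomorphism_quotient_map[OF u]]
      arg_cong[OF eq, of fn] by (simp add: contraction_map_def)
next
  assume A: "pointed_matroid (src f)" and B: "pointed_matroid (tgt f)"
    and q: "quotient_map (src f) (tgt f) (fn f)"
  interpret A: pointed_matroid "src f" by fact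
  interpret B: pointed_matroid "tgt f" by fact
  have f: "strong_map (src f) (tgt f) (fn f)" using q by (simp add: quotient_map_def)
  define S where "S = {x \<in> ground (src f). fn f x = pt (tgt f)} - {pt (src f)}"
  have S: "S \<subseteq> ground (src f)" "pt (src f) \<notin> S" by (auto simp: S_def)
  define v where "v = restrict (fn f) (ground (contraction (src f) S))"
  define u where "u = \<lparr>src = contraction (src f) S, tgt = tgt f, fn = v\<rparr>"
  have sv: "strong_map (contraction (src f) S) (tgt f) v"
    unfolding v_def
  proof (rule strong_map_restrictI)
    fix F assume F: "F \<in> flats (tgt f)"
    have "{x \<in> ground (contraction (src f) S). fn f x \<in> F} = {x \<in> ground (src f). fn f x \<in> F} - S"
      by auto
    moreover have "S \<subseteq> {x \<in> ground (src f). fn f x \<in> F}"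
      using B.pt_flat[OF F] by (auto simp: S_def)
    ultimately show "{x \<in> ground (contraction (src f) S). fn f x \<in> F} \<in> flats (contraction (src f) S)"
      using strong_map_flat[OF f F] S by (auto simp: A.flats_contraction)
  qed (use A.pt_ground S strong_map_pt[OF f] strong_map_app[OF f] in auto)
  then have u: "u \<in> Hom Mat (contraction (src f) S) (tgt f)"
    using B pointed_matroid_contraction[OF A S] by (simp add: Hom_Mat u_def)
  have inj: "inj_on v (ground (contraction (src f) S))"
  proof (rule inj_onI)
    fix x y assume xy: "x \<in> ground (contraction (src f) S)" "y \<in> ground (contraction (src f) S)" "v x = v y"
    then have "fn f x = fn f y" by (simp add: v_def)
    then have "x = y \<or> fn f x = pt (tgt f) \<and> fn f y = pt (tgt f)" using xy q by (auto simp: quotient_map_def)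
    then show "x = y" using xy by (auto simp: S_def)
  qed
  have "quotient_map (contraction (src f) S) (tgt f) v"
    unfolding quotient_map_def
  proof (intro conjI ballI allI impI)
    show "v ` ground (contraction (src f) S) = ground (tgt f)"
    proof
      show "ground (tgt f) \<subseteq> v ` ground (contraction (src f) S)"
      proof
        fix y assume "y \<in> ground (tgt f)"
        then obtain x where x: "x \<in> ground (src f)" "y = fn f x" using quotient_map_surj[OF q] by blast
        show "y \<in> v ` ground (contraction (src f) S)"
          using x S A.pt_ground strong_map_pt[OF f]
          by (cases "x \<in> S") (auto simp: v_def image_iff S_def intro: bexI[of _ "pt (src f)"])
      qed
    qed (use strong_map_app[OF sv] in auto)
    fix F assume F: "F \<subseteq> ground (tgt f)"
      "{x \<in> ground (contraction (src f) S). v x \<in> F} \<in> flats (contraction (src f) S)"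
    then obtain G where G: "G \<in> flats (src f)" "S \<subseteq> G"
      "{x \<in> ground (contraction (src f) S). v x \<in> F} = G - S"
      using S by (auto simp: A.flats_contraction)
    have eq: "{x \<in> ground (src f). x \<notin> S \<and> fn f x \<in> F} = G - S"
      unfolding G(3)[symmetric] by (auto simp: v_def)
    \<comment> \<open>The hypothesis on \<open>F\<close> only controls its preimage outside
      \<open>S\<close>. Since the point maps into \<open>F\<close>, so does all of \<open>S\<close>,
      and the full preimage is the flat \<open>G\<close>.\<close>
    have "pt (src f) \<in> G - S" using A.pt_flat[OF G(1)] S by auto
    then have "fn f (pt (src f)) \<in> F" unfolding eq[symmetric] by simp
    then have "S \<subseteq> {x \<in> ground (src f). fn f x \<in> F}"
      using strong_map_pt[OF f] by (auto simp: S_def)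
    then have "{x \<in> ground (src f). fn f x \<in> F} = G" using eq G(2) by blast
    then have "{x \<in> ground (src f). fn f x \<in> F} \<in> flats (src f)" using G(1) by simp
    then show "F \<in> flats (tgt f)" using quotient_map_flat[OF q F(1)] by blast
  qed (use sv inj in \<open>auto simp: inj_on_def\<close>)
  then have "u \<in> isomorphisms Mat"
    using inj by (intro inj_quotient_map_isomorphism[OF u]) (auto simp: u_def)
  moreover have "f = u \<cdot>\<^bsub>Mat\<^esub> contraction_map (src f) S"
  proof (rule arrow_eqI)
    show "f \<in> Hom Mat (src f) (tgt f)" using A B f by (simp add: Hom_Mat)
    show "u \<cdot>\<^bsub>Mat\<^esub> contraction_map (src f) S \<in> Hom Mat (src f) (tgt f)"
      using quotient_map_contraction_map[OF A S] pointed_matroid_contraction[OF A S] A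
      by (intro Mat.Comp_in_Hom[OF _ u]) (simp add: Hom_Mat contraction_map_def quotient_map_def)
  qed (use A.pt_ground strong_map_pt[OF f] S in \<open>auto simp: u_def v_def contraction_map_def compose_def S_def\<close>)
  moreover have "f \<in> Ar Mat" using A B f by (simp add: Ar_Mat)
  ultimately show "f \<in> mat_contractions" using S u unfolding mat_contractions_def by blast
qed

section \<open>Cartesian and co-Cartesian squares\<close>

text \<open>The factor is \<open>g\<close> followed by the inverse of \<open>i\<close> on its image.
  It is strong because each flat of \<open>A\<close> is the preimage of a flat \<open>G\<close> of
  \<open>B\<close>, so its preimage under the factor is that of \<open>G\<close> under
  \<open>g\<close>.\<close>

lemma embedding_factor:
  assumes T: "pointed_matroid T" and A: "pointed_matroid A"
    and i: "embedding A B i" and g: "strong_map T B g"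
    and im: "g ` ground T \<subseteq> i ` ground A"
  obtains u where "strong_map T A u" "\<And>t. t \<in> ground T \<Longrightarrow> i (u t) = g t"
proof -
  interpret T: pointed_matroid T by fact
  interpret A: pointed_matroid A by fact
  have si: "strong_map A B i" and inj: "inj_on i (ground A)" using i by (auto simp: embedding_def)
  let ?u = "\<lambda>t. inv_into (ground A) i (g t)"
  have u: "?u t \<in> ground A" "i (?u t) = g t" if "t \<in> ground T" for t
    using im that by (auto intro!: inv_into_into f_inv_into_f)
  have "strong_map T A (restrict ?u (ground T))"
  proof (rule strong_map_restrictI)
    show "?u (pt T) = pt A"
      using strong_map_pt[OF g] strong_map_pt[OF si] inj A.pt_ground
      by (metis inv_into_f_f)
    fix F assume "F \<in> flats A"
    then obtain G where G: "G \<in> flats B" "F = {x \<in> ground A. i x \<in> G}"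
      using i by (auto simp: embedding_def)
    then have "{t \<in> ground T. ?u t \<in> F} = {t \<in> ground T. g t \<in> G}" using u by auto
    then show "{t \<in> ground T. ?u t \<in> F} \<in> flats T" using strong_map_flat[OF g G(1)] by simp
  qed (use u T.pt_ground in auto)
  then show thesis using that[of "restrict ?u (ground T)"] u by simp
qed

text \<open>The factor evaluates \<open>g\<close> at any chosen preimage. The choice is harmless:
  the fibres of \<open>q\<close> are singletons except over the point, where \<open>g\<close> is
  constant by \<open>ker\<close>.\<close>

lemma quotient_map_factor:
  assumes B: "pointed_matroid B" "pointed_matroid C"
    and q: "quotient_map B C q" and g: "strong_map B X g"
    and ker: "\<forall>y \<in> ground B. q y = pt C \<longrightarrow> g y = pt X"
  obtains u where "strong_map C X u" "\<And>y. y \<in> ground B \<Longrightarrow> u (q y) = g y"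
proof -
  interpret B: pointed_matroid B by fact
  interpret C: pointed_matroid C by fact
  have sq: "strong_map B C q" and surj: "q ` ground B = ground C"
    and fib: "\<And>x y. x \<in> ground B \<Longrightarrow> y \<in> ground B \<Longrightarrow> q x = q y \<Longrightarrow> x = y \<or> q x = pt C"
    and fl: "\<And>F. F \<subseteq> ground C \<Longrightarrow> {y \<in> ground B. q y \<in> F} \<in> flats B \<Longrightarrow> F \<in> flats C"
    using q quotient_map_fibre[OF q] quotient_map_flat[OF q] by (simp_all add: quotient_map_def)
  let ?u = "\<lambda>y. g (inv_into (ground B) q y)"
  have inv: "inv_into (ground B) q z \<in> ground B" "q (inv_into (ground B) q z) = z" if "z \<in> ground C" for z
    using that surj by (auto intro!: inv_into_into f_inv_into_f)
  have u: "?u (q y) = g y" if "y \<in> ground B" for y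
  proof -
    have "q y \<in> ground C" using that surj by auto
    from inv[OF this] have "inv_into (ground B) q (q y) = y \<or> q y = pt C"
      using fib[of "inv_into (ground B) q (q y)" y] that by simp
    then show ?thesis using ker inv[OF \<open>q y \<in> ground C\<close>] that
      by (metis (full_types))
  qed
  have "strong_map C X (restrict ?u (ground C))"
  proof (rule strong_map_restrictI)
    show "?u (pt C) = pt X" using u[OF B.pt_ground] strong_map_pt[OF sq] strong_map_pt[OF g] by simp
    fix F assume F: "F \<in> flats X"
    \<comment> \<open>A subset of \<open>C\<close> is tested for flatness by its preimage in
      \<open>B\<close>, and here this preimage is the one taken along \<open>g\<close>.\<close>
    have "{y \<in> ground B. q y \<in> {z \<in> ground C. ?u z \<in> F}} = {y \<in> ground B. g y \<in> F}"
      using u strong_map_app[OF sq] by auto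
    then show "{z \<in> ground C. ?u z \<in> F} \<in> flats C" using strong_map_flat[OF g F] fl by simp
  qed (use C.pt_ground inv strong_map_app[OF g] in auto)
  then show thesis using that[of "restrict ?u (ground C)"] u strong_map_app[OF sq] by simp
qed

lemma cartesian_lift:
  assumes "cartesian C i j j' i'" "T \<in> Ob C" "g \<in> Hom C T (Dom C j')" "h \<in> Hom C T (Dom C i')"
    and "j' \<cdot>\<^bsub>C\<^esub> g = i' \<cdot>\<^bsub>C\<^esub> h"
  shows "\<exists>u \<in> Hom C T (Dom C i). i \<cdot>\<^bsub>C\<^esub> u = g \<and> j \<cdot>\<^bsub>C\<^esub> u = h"
  using assms unfolding cartesian_def by blast

lemma cocartesian_desc:
  assumes "cocartesian C i j j' i'" "T \<in> Ob C" "g \<in> Hom C (Cod C i) T" "h \<in> Hom C (Cod C j) T"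
    and "g \<cdot>\<^bsub>C\<^esub> i = h \<cdot>\<^bsub>C\<^esub> j"
  shows "\<exists>u \<in> Hom C (Cod C i') T. u \<cdot>\<^bsub>C\<^esub> j' = g \<and> u \<cdot>\<^bsub>C\<^esub> i' = h"
  using assms unfolding cocartesian_def by blast

lemma comp_eq_iff:
  assumes "f \<in> Hom Mat A B" "g \<in> Hom Mat B D" "f' \<in> Hom Mat A B'" "g' \<in> Hom Mat B' D"
  shows "g \<cdot>\<^bsub>Mat\<^esub> f = g' \<cdot>\<^bsub>Mat\<^esub> f' \<longleftrightarrow> (\<forall>x \<in> ground A. fn g (fn f x) = fn g' (fn f' x))"
proof
  assume "g \<cdot>\<^bsub>Mat\<^esub> f = g' \<cdot>\<^bsub>Mat\<^esub> f'"
  from arg_cong[OF this, of fn] have "compose (ground A) (fn g) (fn f) = compose (ground A) (fn g') (fn f')"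
    using assms by (simp add: Hom_Mat)
  then show "\<forall>x \<in> ground A. fn g (fn f x) = fn g' (fn f' x)" by (metis compose_eq)
next
  assume "\<forall>x \<in> ground A. fn g (fn f x) = fn g' (fn f' x)"
  then show "g \<cdot>\<^bsub>Mat\<^esub> f = g' \<cdot>\<^bsub>Mat\<^esub> f'"
    using assms by (intro arrow_eqI[OF Mat.Comp_in_Hom Mat.Comp_in_Hom]) (auto simp: Hom_Mat compose_eq)
qed

lemma comp_eq_arrow_iff:
  assumes "f \<in> Hom Mat A B" "g \<in> Hom Mat B D" "h \<in> Hom Mat A D"
  shows "g \<cdot>\<^bsub>Mat\<^esub> f = h \<longleftrightarrow> (\<forall>x \<in> ground A. fn g (fn f x) = fn h x)"
proof
  assume "g \<cdot>\<^bsub>Mat\<^esub> f = h"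
  from arg_cong[OF this, of fn] have "compose (ground A) (fn g) (fn f) = fn h"
    using assms by (simp add: Hom_Mat)
  then show "\<forall>x \<in> ground A. fn g (fn f x) = fn h x" by (metis compose_eq)
next
  assume "\<forall>x \<in> ground A. fn g (fn f x) = fn h x"
  then show "g \<cdot>\<^bsub>Mat\<^esub> f = h"
    using assms by (intro arrow_eqI[OF Mat.Comp_in_Hom]) (auto simp: Hom_Mat compose_eq)
qed

lemma restriction_in_Hom:
  assumes "f \<in> mat_restrictions"
  shows "f \<in> Hom Mat (src f) (tgt f)" "embedding (src f) (tgt f) (fn f)"
  using assms by (auto simp: mat_restrictions_iff Hom_Mat embedding_def)

lemma contraction_in_Hom:
  assumes "f \<in> mat_contractions"
  shows "f \<in> Hom Mat (src f) (tgt f)" "quotient_map (src f) (tgt f) (fn f)"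
  using assms by (auto simp: mat_contractions_iff Hom_Mat quotient_map_def)

lemma commutative_square_Mat:
  "commutative_square Mat i j j' i' \<longleftrightarrow>
     i \<in> Hom Mat (src i) (tgt i) \<and> j \<in> Hom Mat (src i) (tgt j) \<and>
     j' \<in> Hom Mat (tgt i) (tgt j') \<and> i' \<in> Hom Mat (tgt j) (tgt j') \<and>
     (\<forall>x \<in> ground (src i). fn j' (fn i x) = fn i' (fn j x))" (is "?L \<longleftrightarrow> ?R")
proof
  assume L: ?L
  then have H: "i \<in> Hom Mat (src i) (tgt i)" "j \<in> Hom Mat (src i) (tgt j)"
    "j' \<in> Hom Mat (tgt i) (tgt j')" "i' \<in> Hom Mat (tgt j) (tgt j')"
    by (simp_all add: commutative_square_def Hom_def)
  then show ?R using L comp_eq_iff[OF H(1) H(3) H(2) H(4)] by (simp add: commutative_square_def)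
next
  assume R: ?R
  then have "i \<in> Hom Mat (src i) (tgt i)" "j \<in> Hom Mat (src i) (tgt j)"
    "j' \<in> Hom Mat (tgt i) (tgt j')" "i' \<in> Hom Mat (tgt j) (tgt j')"  by blast+
  note H = this
  have "j' \<cdot>\<^bsub>Mat\<^esub> i = i' \<cdot>\<^bsub>Mat\<^esub> j" using R comp_eq_iff[OF H(1) H(3) H(2) H(4)] by blast
  then show ?L using H by (simp add: commutative_square_def Ar_Mat Hom_Mat)
qed

section \<open>The kernel criterion for Cartesian and co-Cartesian squares\<close>

text \<open>Every flat contains the point, so all preimages are the full ground set, which is a
  flat.\<close>

lemma strong_map_const:
  assumes "pointed_matroid T" "pointed_matroid A"
  shows "strong_map T A (\<lambda>x \<in> ground T. pt A)"
proof -
  interpret T: pointed_matroid T by fact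
  interpret A: pointed_matroid A by fact
  show ?thesis
    using T.pt_ground T.ground_flat A.pt_ground A.pt_flat by (intro strong_map_restrictI) auto
qed

text \<open>Once \<open>g\<close> is known to take values in the image of \<open>i\<close>,
  \<open>embedding_factor\<close> supplies the lift. Its compatibility with \<open>j\<close> follows
  by cancelling the injective \<open>i'\<close>, and uniqueness by cancelling the injective
  \<open>i\<close>.\<close>

lemma cartesian_if_kernel:
  assumes i: "i \<in> mat_restrictions" and i': "i' \<in> mat_restrictions"
    and j: "j \<in> mat_contractions" and j': "j' \<in> mat_contractions"
    and sq: "commutative_square Mat i j j' i'"
    and ker: "\<And>y. y \<in> ground (tgt i) \<Longrightarrow> fn j' y = pt (tgt j') \<Longrightarrow> y \<in> fn i ` ground (src i)"
  shows "cartesian Mat i j j' i'"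
  unfolding cartesian_def
proof (intro conjI ballI impI)
  have H: "i \<in> Hom Mat (src i) (tgt i)" "j \<in> Hom Mat (src i) (tgt j)"
    "j' \<in> Hom Mat (tgt i) (tgt j')" "i' \<in> Hom Mat (tgt j) (tgt j')"
    and c: "\<And>x. x \<in> ground (src i) \<Longrightarrow> fn j' (fn i x) = fn i' (fn j x)"
    using sq by (auto simp: commutative_square_Mat)
  have [simp]: "src j = src i" "src j' = tgt i" "src i' = tgt j" "tgt i' = tgt j'" using H by (auto simp: Hom_Mat)
  have ei: "embedding (src i) (tgt i) (fn i)" and ei': "embedding (tgt j) (tgt j') (fn i')"
    and qj: "quotient_map (src i) (tgt j) (fn j)" and qj': "quotient_map (tgt i) (tgt j') (fn j')"
    using restriction_in_Hom(2)[OF i] restriction_in_Hom(2)[OF i']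
      contraction_in_Hom(2)[OF j] contraction_in_Hom(2)[OF j'] by simp_all
  fix T g h assume T: "T \<in> Ob Mat" and g: "g \<in> Hom Mat T (Dom Mat j')" and h: "h \<in> Hom Mat T (Dom Mat i')"
    and eq: "j' \<cdot>\<^bsub>Mat\<^esub> g = i' \<cdot>\<^bsub>Mat\<^esub> h"
  have g: "g \<in> Hom Mat T (tgt i)" and h: "h \<in> Hom Mat T (tgt j)" using g h by simp_all
  have e: "fn j' (fn g t) = fn i' (fn h t)" if "t \<in> ground T" for t
    using eq comp_eq_iff[OF g H(3) h H(4)] that by blast
  have app: "fn g t \<in> ground (tgt i)" "fn h t \<in> ground (tgt j)" if "t \<in> ground T" for t
    using g h that by (auto simp: Hom_Mat strong_map_app)
  \<comment> \<open>Write \<open>h t\<close> as \<open>j a\<close>, using that \<open>j\<close> is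
    onto. Then \<open>g t\<close> and \<open>i a\<close> have the same image under
    \<open>j'\<close>, so they coincide or \<open>g t\<close> lies in the kernel of
    \<open>j'\<close>; the hypothesis \<open>ker\<close> covers the second case.\<close>
  have im: "fn g ` ground T \<subseteq> fn i ` ground (src i)"
  proof
    fix y assume "y \<in> fn g ` ground T"
    then obtain t where t: "t \<in> ground T" "y = fn g t" by blast
    obtain a where a: "a \<in> ground (src i)" "fn h t = fn j a"
      using quotient_map_surj[OF qj app(2)[OF t(1)]] by blast
    have "fn j' y = fn j' (fn i a)" using e t a c by simp
    then have "y = fn i a \<or> fn j' y = pt (tgt j')"
      using quotient_map_fibre[OF qj', of y "fn i a"] t app(1) a(1) H(1) by (auto simp: Hom_Mat strong_map_app)
    then show "y \<in> fn i ` ground (src i)" using ker[of y] app(1) t a by blast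
  qed
  have pT: "pointed_matroid T" and A: "pointed_matroid (src i)" using T H(1) by (simp_all add: Hom_Mat)
  have sg: "strong_map T (tgt i) (fn g)" using g by (simp add: Hom_Mat)
  obtain w where w: "strong_map T (src i) w" "\<And>t. t \<in> ground T \<Longrightarrow> fn i (w t) = fn g t"
    using embedding_factor[OF pT A ei sg im] by blast
  define u where "u = \<lparr>src = T, tgt = src i, fn = w\<rparr>"
  have u: "u \<in> Hom Mat T (src i)" using w T H(1) by (simp add: Hom_Mat u_def)
  have "fn j (w t) = fn h t" if t: "t \<in> ground T" for t
  proof -
    have wt: "w t \<in> ground (src i)" using w(1) t by (rule strong_map_app)
    then have "fn j (w t) \<in> ground (tgt j)" using H(2) by (auto simp: Hom_Mat strong_map_app)
    moreover have "fn i' (fn j (w t)) = fn i' (fn h t)" using c[OF wt] w(2)[OF t] e[OF t] by simp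
    ultimately show ?thesis using ei' app(2)[OF t] by (auto simp: embedding_def inj_on_def)
  qed
  then have 1: "i \<cdot>\<^bsub>Mat\<^esub> u = g" "j \<cdot>\<^bsub>Mat\<^esub> u = h"
    using comp_eq_arrow_iff[OF u H(1) g] comp_eq_arrow_iff[OF u H(2) h] w(2) by (simp_all add: u_def)
  show "\<exists>!u. u \<in> Hom Mat T (Dom Mat i) \<and> i \<cdot>\<^bsub>Mat\<^esub> u = g \<and> j \<cdot>\<^bsub>Mat\<^esub> u = h"
  proof (rule ex1I[of _ u])
    fix v assume v: "v \<in> Hom Mat T (Dom Mat i) \<and> i \<cdot>\<^bsub>Mat\<^esub> v = g \<and> j \<cdot>\<^bsub>Mat\<^esub> v = h"
    then have v': "v \<in> Hom Mat T (src i)" by simp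
    show "v = u"
    proof (rule arrow_eqI[OF v' u])
      fix t assume t: "t \<in> ground T"
      have "fn i (fn v t) = fn i (fn u t)"
        using comp_eq_iff[OF v' H(1) u H(1)] v 1 t by simp
      moreover have "fn v t \<in> ground (src i)" "fn u t \<in> ground (src i)"
        using v' u t by (auto simp: Hom_Mat strong_map_app)
      ultimately show "fn v t = fn u t" using ei by (auto simp: embedding_def inj_on_def)
    qed
  qed (use u 1 in simp)
qed (rule sq)

text \<open>The inclusion of the kernel \<open>K\<close> of \<open>j'\<close> and the constant map
  from \<open>K\<close> to the point of the other corner agree over the target. The lift given by
  the Cartesian property exhibits each element of \<open>K\<close> as a value of
  \<open>i\<close>.\<close>

lemma kernel_if_cartesian:
  assumes j': "j' \<in> mat_contractions"
    and c: "cartesian Mat i j j' i'"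
    and y: "y \<in> ground (tgt i)" "fn j' y = pt (tgt j')"
  shows "y \<in> fn i ` ground (src i)"
proof -
  have sq: "commutative_square Mat i j j' i'" using c by (simp add: cartesian_def)
  then have H: "i \<in> Hom Mat (src i) (tgt i)" "j \<in> Hom Mat (src i) (tgt j)"
    "j' \<in> Hom Mat (tgt i) (tgt j')" "i' \<in> Hom Mat (tgt j) (tgt j')"
    by (auto simp: commutative_square_Mat)
  have B: "pointed_matroid (tgt i)" and A': "pointed_matroid (tgt j)" using H by (auto simp: Hom_Mat)
  interpret B: pointed_matroid "tgt i" by (rule B)
  define K where "K = {y \<in> ground (tgt i). fn j' y = pt (tgt j')}"
  have K: "K \<subseteq> ground (tgt i)" "pt (tgt i) \<in> K"
    using H(3) B.pt_ground strong_map_pt by (auto simp: K_def Hom_Mat)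
  have R: "pointed_matroid (restriction (tgt i) K)" using pointed_matroid_restriction[OF B K] .
  have g: "restriction_map (tgt i) K \<in> Hom Mat (restriction (tgt i) K) (tgt i)"
    using embedding_restriction_map[OF B K] R B by (simp add: Hom_Mat restriction_map_def embedding_def)
  define h where "h = \<lparr>src = restriction (tgt i) K, tgt = tgt j, fn = (\<lambda>x \<in> K. pt (tgt j))\<rparr>"
  have h: "h \<in> Hom Mat (restriction (tgt i) K) (tgt j)"
    using strong_map_const[OF R A'] R A' by (simp add: Hom_Mat h_def)
  have "j' \<cdot>\<^bsub>Mat\<^esub> restriction_map (tgt i) K = i' \<cdot>\<^bsub>Mat\<^esub> h"
    using H(4) unfolding comp_eq_iff[OF g H(3) h H(4)]
    by (auto simp: h_def restriction_map_def K_def Hom_Mat strong_map_pt)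
  moreover have "src j' = tgt i" "src i' = tgt j" using H by (auto simp: Hom_Mat)
  ultimately obtain u where u: "u \<in> Hom Mat (restriction (tgt i) K) (src i)"
    "i \<cdot>\<^bsub>Mat\<^esub> u = restriction_map (tgt i) K"
    using cartesian_lift[OF c, of "restriction (tgt i) K"] R g h by auto
  have yK: "y \<in> K" using y by (simp add: K_def)
  then have "fn i (fn u y) = y"
    using u comp_eq_arrow_iff[OF u(1) H(1) g] by (simp add: restriction_map_def)
  moreover have "fn u y \<in> ground (src i)" using u(1) yK strong_map_app by (fastforce simp: Hom_Mat)
  ultimately show ?thesis by (metis imageI)
qed

text \<open>Once \<open>g\<close> is known to send the kernel of \<open>j'\<close> to the point,
  \<open>quotient_map_factor\<close> supplies the induced map. Its compatibility with
  \<open>i'\<close> uses that \<open>j\<close> is onto, and uniqueness that \<open>j'\<close> is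
  onto.\<close>

lemma cocartesian_if_kernel:
  assumes i: "i \<in> mat_restrictions" and i': "i' \<in> mat_restrictions"
    and j: "j \<in> mat_contractions" and j': "j' \<in> mat_contractions"
    and sq: "commutative_square Mat i j j' i'"
    and ker: "\<And>y. y \<in> ground (tgt i) \<Longrightarrow> fn j' y = pt (tgt j') \<Longrightarrow> y \<in> fn i ` ground (src i)"
  shows "cocartesian Mat i j j' i'"
  unfolding cocartesian_def
proof (intro conjI ballI impI)
  have H: "i \<in> Hom Mat (src i) (tgt i)" "j \<in> Hom Mat (src i) (tgt j)"
    "j' \<in> Hom Mat (tgt i) (tgt j')" "i' \<in> Hom Mat (tgt j) (tgt j')"
    and c: "\<And>x. x \<in> ground (src i) \<Longrightarrow> fn j' (fn i x) = fn i' (fn j x)"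
    using sq by (auto simp: commutative_square_Mat)
  have s[simp]: "src j = src i" "src j' = tgt i" "src i' = tgt j" "tgt i' = tgt j'" using H by (auto simp: Hom_Mat)
  have ei': "embedding (tgt j) (tgt j') (fn i')"
    and qj: "quotient_map (src i) (tgt j) (fn j)" and qj': "quotient_map (tgt i) (tgt j') (fn j')"
    using restriction_in_Hom(2)[OF i']
      contraction_in_Hom(2)[OF j] contraction_in_Hom(2)[OF j'] by simp_all
  interpret A': pointed_matroid "tgt j" using H by (simp add: Hom_Mat)
  fix X g h assume X: "X \<in> Ob Mat" and g: "g \<in> Hom Mat (Cod Mat i) X" and h: "h \<in> Hom Mat (Cod Mat j) X"
    and eq: "g \<cdot>\<^bsub>Mat\<^esub> i = h \<cdot>\<^bsub>Mat\<^esub> j"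
  have g: "g \<in> Hom Mat (tgt i) X" and h: "h \<in> Hom Mat (tgt j) X" using g h by simp_all
  have e: "fn g (fn i x) = fn h (fn j x)" if "x \<in> ground (src i)" for x
    using eq comp_eq_iff[OF H(1) g H(2) h] that by blast
  \<comment> \<open>An element of the kernel is some \<open>i a\<close>. Then \<open>i'\<close>
    sends \<open>j a\<close> to the point, so \<open>j a\<close> is the point by injectivity, and
    \<open>g (i a) = h (j a)\<close> is the point as well.\<close>
  have kg: "\<forall>y \<in> ground (tgt i). fn j' y = pt (tgt j') \<longrightarrow> fn g y = pt X"
  proof (intro ballI impI)
    fix y assume y: "y \<in> ground (tgt i)" "fn j' y = pt (tgt j')"
    obtain a where a: "a \<in> ground (src i)" "y = fn i a" using ker[OF y] by blast
    have "fn i' (pt (tgt j)) = pt (tgt j')" using H(4) by (auto simp: Hom_Mat strong_map_pt)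
    then have "fn i' (fn j a) = fn i' (pt (tgt j))" using c[OF a(1)] a(2) y(2) by simp
    moreover have "fn j a \<in> ground (tgt j)" using a H(2) by (auto simp: Hom_Mat strong_map_app)
    ultimately have "fn j a = pt (tgt j)" using ei' A'.pt_ground by (auto simp: embedding_def inj_on_def)
    then show "fn g y = pt X" using e[OF a(1)] a(2) h by (simp add: Hom_Mat strong_map_pt)
  qed
  have B: "pointed_matroid (tgt i)" and B': "pointed_matroid (tgt j')" using H(3) by (simp_all add: Hom_Mat)
  have sg: "strong_map (tgt i) X (fn g)" using g by (simp add: Hom_Mat)
  obtain w where w: "strong_map (tgt j') X w" "\<And>y. y \<in> ground (tgt i) \<Longrightarrow> w (fn j' y) = fn g y"
    using quotient_map_factor[OF B B' qj' sg kg] by blast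
  define u where "u = \<lparr>src = tgt j', tgt = X, fn = w\<rparr>"
  have u: "u \<in> Hom Mat (tgt j') X" using w X H(3) by (simp add: Hom_Mat u_def)
  have "w (fn i' b) = fn h b" if b: "b \<in> ground (tgt j)" for b
  proof -
    obtain a where a: "a \<in> ground (src i)" "b = fn j a" using quotient_map_surj[OF qj b] by blast
    have "fn i a \<in> ground (tgt i)" using H(1) a(1) by (auto simp: Hom_Mat strong_map_app)
    then show ?thesis using c[OF a(1)] e[OF a(1)] w(2)[of "fn i a"] a(2) by simp
  qed
  then have 1: "u \<cdot>\<^bsub>Mat\<^esub> j' = g" "u \<cdot>\<^bsub>Mat\<^esub> i' = h"
    using comp_eq_arrow_iff[OF H(3) u g] comp_eq_arrow_iff[OF H(4) u h] w(2) by (simp_all add: u_def)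
  show "\<exists>!u. u \<in> Hom Mat (Cod Mat i') X \<and> u \<cdot>\<^bsub>Mat\<^esub> j' = g \<and> u \<cdot>\<^bsub>Mat\<^esub> i' = h"
  proof (rule ex1I[of _ u])
    fix v assume v: "v \<in> Hom Mat (Cod Mat i') X \<and> v \<cdot>\<^bsub>Mat\<^esub> j' = g \<and> v \<cdot>\<^bsub>Mat\<^esub> i' = h"
    then have v': "v \<in> Hom Mat (tgt j') X" by simp
    show "v = u"
    proof (rule arrow_eqI[OF v' u])
      fix z assume "z \<in> ground (tgt j')"
      then obtain y where "y \<in> ground (tgt i)" "z = fn j' y" using quotient_map_surj[OF qj'] by blast
      then show "fn v z = fn u z" using comp_eq_iff[OF H(3) v' H(3) u] v 1 by simp
    qed
  qed (use u 1 in simp)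
qed (rule sq)

section \<open>Completion of spans and cospans\<close>

text \<open>The missing corner is the target of \<open>i\<close> with the image of the kernel of
  \<open>j\<close> contracted, the point being kept. The kernel condition is part of the conclusion
  because both universal properties follow from it.\<close>

lemma span_square:
  assumes i: "i \<in> mat_restrictions" and j: "j \<in> mat_contractions" and s: "src i = src j"
  obtains i' j' where "i' \<in> mat_restrictions" "j' \<in> mat_contractions" "commutative_square Mat i j j' i'"
    "\<And>y. y \<in> ground (tgt i) \<Longrightarrow> fn j' y = pt (tgt j') \<Longrightarrow> y \<in> fn i ` ground (src i)"
proof -
  have Hi: "i \<in> Hom Mat (src i) (tgt i)" and ei: "embedding (src i) (tgt i) (fn i)"
    and Hj: "j \<in> Hom Mat (src i) (tgt j)" and qj: "quotient_map (src i) (tgt j) (fn j)"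
    using restriction_in_Hom[OF i] contraction_in_Hom[OF j] s by simp_all
  interpret A: pointed_matroid "src i" using Hi by (simp add: Hom_Mat)
  interpret B: pointed_matroid "tgt i" using Hi by (simp add: Hom_Mat)
  interpret A': pointed_matroid "tgt j" using Hj by (simp add: Hom_Mat)
  have B: "pointed_matroid (tgt i)" ..
  have A': "pointed_matroid (tgt j)" ..
  have si: "strong_map (src i) (tgt i) (fn i)" and sj: "strong_map (src i) (tgt j) (fn j)"
    using Hi Hj by (auto simp: Hom_Mat)
  have inj: "inj_on (fn i) (ground (src i))" using ei by (simp add: embedding_def)
  define S where "S = fn i ` {x \<in> ground (src i). fn j x = pt (tgt j)} - {pt (tgt i)}"
  have S: "S \<subseteq> ground (tgt i)" "pt (tgt i) \<notin> S" using strong_map_app[OF si] by (auto simp: S_def)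
  define C where "C = contraction (tgt i) S"
  define q where "q = (\<lambda>y \<in> ground (tgt i). if y \<in> S then pt (tgt i) else y)"
  have C: "pointed_matroid C" and qq: "quotient_map (tgt i) C q"
    using pointed_matroid_contraction[OF B S] quotient_map_contraction_map[OF B S]
    by (simp_all add: C_def q_def)
  have [simp]: "pt C = pt (tgt i)" by (simp add: C_def)
  have sq: "strong_map (tgt i) C q" using qq by (simp add: quotient_map_def)
  \<comment> \<open>An element of the source is collapsed by \<open>q\<close> after \<open>i\<close>
    exactly when \<open>j\<close> collapses it. One direction lets \<open>q\<close> after
    \<open>i\<close> factor through \<open>j\<close> as \<open>k\<close>; the other makes
    \<open>k\<close> injective.\<close>
  have Sj: "fn i x \<in> S \<or> fn i x = pt (tgt i) \<longleftrightarrow> fn j x = pt (tgt j)" if x: "x \<in> ground (src i)" for x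
  proof
    assume "fn i x \<in> S \<or> fn i x = pt (tgt i)"
    then show "fn j x = pt (tgt j)"
    proof
      assume "fn i x \<in> S"
      then show ?thesis using x inj by (auto simp: S_def inj_on_def)
    next
      assume "fn i x = pt (tgt i)"
      then have "x = pt (src i)"
        using strong_map_pt[OF si] inj x A.pt_ground by (auto simp: inj_on_def)
      then show ?thesis using strong_map_pt[OF sj] by simp
    qed
  qed (use x in \<open>auto simp: S_def\<close>)
  have g: "strong_map (src i) C (compose (ground (src i)) q (fn i))"
    using strong_map_comp[OF _ si sq] A.pointed_matroid_axioms by blast
  have ker: "\<forall>x \<in> ground (src i). fn j x = pt (tgt j) \<longrightarrow> compose (ground (src i)) q (fn i) x = pt C"
    using Sj strong_map_app[OF si] by (auto simp: compose_def q_def)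
  obtain k where k: "strong_map (tgt j) C k" and kj0: "\<And>x. x \<in> ground (src i) \<Longrightarrow>
      k (fn j x) = compose (ground (src i)) q (fn i) x"
    using quotient_map_factor[OF A.pointed_matroid_axioms A' qj g ker] by blast
  then have kj: "k (fn j x) = q (fn i x)" if "x \<in> ground (src i)" for x
    using that by (simp add: compose_def)
  have surj: "\<exists>x \<in> ground (src i). b = fn j x" if "b \<in> ground (tgt j)" for b
    using quotient_map_surj[OF qj that] .
  have "embedding (tgt j) C k"
    unfolding embedding_def
  proof (intro conjI ballI k inj_onI)
    fix b d assume b: "b \<in> ground (tgt j)" and d: "d \<in> ground (tgt j)" and eq: "k b = k d"
    obtain x where x: "x \<in> ground (src i)" "b = fn j x" using surj[OF b] by blast
    obtain y where y: "y \<in> ground (src i)" "d = fn j y" using surj[OF d] by blast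
    have "q (fn i x) = q (fn i y)" using eq kj x y by simp
    then have "fn i x = fn i y \<or> (fn i x \<in> S \<or> fn i x = pt (tgt i)) \<and> (fn i y \<in> S \<or> fn i y = pt (tgt i))"
      using strong_map_app[OF si x(1)] strong_map_app[OF si y(1)] by (auto simp: q_def split: if_splits)
    then have "x = y \<or> fn j x = pt (tgt j) \<and> fn j y = pt (tgt j)"
      using Sj[OF x(1)] Sj[OF y(1)] inj x(1) y(1) by (auto simp: inj_on_def)
    then show "b = d" using x y by auto
  next
    fix F assume F: "F \<in> flats (tgt j)"
    then have "{x \<in> ground (src i). fn j x \<in> F} \<in> flats (src i)" by (rule strong_map_flat[OF sj])
    then obtain G where G: "G \<in> flats (tgt i)"
      "{x \<in> ground (src i). fn j x \<in> F} = {x \<in> ground (src i). fn i x \<in> G}"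
      using ei unfolding embedding_def by blast
    \<comment> \<open>\<open>F\<close> contains the point, so its preimage under \<open>j\<close>
      contains the kernel of \<open>j\<close>, whose image under \<open>i\<close> therefore lies in
      \<open>G\<close>. Hence \<open>G - S\<close> is a flat of the contraction, and it pulls back
      to \<open>F\<close> along \<open>k\<close>.\<close>
    have "S \<subseteq> G"
    proof
      fix y assume "y \<in> S"
      then obtain x where x: "x \<in> ground (src i)" "fn j x = pt (tgt j)" "y = fn i x" by (auto simp: S_def)
      then have "x \<in> {x \<in> ground (src i). fn j x \<in> F}" using A'.pt_flat[OF F] by simp
      then show "y \<in> G" unfolding G(2) using x(3) by simp
    qed
    then have "G - S \<in> flats C" using G(1) S by (auto simp: C_def B.flats_contraction)
    moreover have "b \<in> F \<longleftrightarrow> k b \<in> G - S" if b: "b \<in> ground (tgt j)" for b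
    proof -
      obtain x where x: "x \<in> ground (src i)" "b = fn j x" using surj[OF b] by blast
      have "q y \<in> G - S \<longleftrightarrow> y \<in> G" if "y \<in> ground (tgt i)" for y
        using \<open>S \<subseteq> G\<close> B.pt_flat[OF G(1)] S that by (auto simp: q_def)
      then have "k b \<in> G - S \<longleftrightarrow> fn i x \<in> G" using kj x strong_map_app[OF si x(1)] by simp
      moreover have "fn i x \<in> G \<longleftrightarrow> fn j x \<in> F" using G(2) x(1) by blast
      ultimately show ?thesis using x by simp
    qed
    moreover have "F \<subseteq> ground (tgt j)" using A'.flat_subset[OF F] .
    ultimately show "\<exists>G \<in> flats C. F = {b \<in> ground (tgt j). k b \<in> G}" by blast
  qed
  then have 1: "\<lparr>src = tgt j, tgt = C, fn = k\<rparr> \<in> mat_restrictions"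
    using C A' by (simp add: mat_restrictions_iff)
  have 2: "\<lparr>src = tgt i, tgt = C, fn = q\<rparr> \<in> mat_contractions"
    using C B qq by (simp add: mat_contractions_iff)
  have 3: "commutative_square Mat i j \<lparr>src = tgt i, tgt = C, fn = q\<rparr> \<lparr>src = tgt j, tgt = C, fn = k\<rparr>"
    using Hi Hj restriction_in_Hom(1)[OF 1] contraction_in_Hom(1)[OF 2] kj
    by (simp add: commutative_square_Mat)
  have "y \<in> fn i ` ground (src i)" if y: "y \<in> ground (tgt i)" "q y = pt C" for y
  proof -
    have "y \<in> S \<or> y = pt (tgt i)" using y by (auto simp: q_def split: if_splits)
    then show ?thesis using strong_map_pt[OF si] A.pt_ground by (auto simp: S_def image_iff) metis
  qed
  then show thesis using that[OF 1 2 3] by simp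
qed

text \<open>The co-Cartesian property gives a map \<open>u\<close> to the explicit square of
  \<open>span_square\<close>. As \<open>u\<close> preserves the point, the kernel of
  \<open>j'\<close> is contained in the kernel of \<open>q\<close>, for which the claim is
  known.\<close>

lemma kernel_if_cocartesian:
  assumes i: "i \<in> mat_restrictions" and j: "j \<in> mat_contractions"
    and c: "cocartesian Mat i j j' i'"
    and y: "y \<in> ground (tgt i)" "fn j' y = pt (tgt j')"
  shows "y \<in> fn i ` ground (src i)"
proof -
  have sq: "commutative_square Mat i j j' i'" using c by (simp add: cocartesian_def)
  then have H: "i \<in> Hom Mat (src i) (tgt i)" "j \<in> Hom Mat (src i) (tgt j)"
    "j' \<in> Hom Mat (tgt i) (tgt j')" "i' \<in> Hom Mat (tgt j) (tgt j')"
    by (auto simp: commutative_square_Mat)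
  then have s: "src i = src j" "tgt i' = tgt j'" by (auto simp: Hom_Mat)
  obtain k q where sq': "commutative_square Mat i j q k"
    and ker: "\<And>y. y \<in> ground (tgt i) \<Longrightarrow> fn q y = pt (tgt q) \<Longrightarrow> y \<in> fn i ` ground (src i)"
    using span_square[OF i j s(1)] by blast
  then have q: "q \<in> Hom Mat (tgt i) (tgt q)" and k: "k \<in> Hom Mat (tgt j) (tgt q)"
    by (auto simp: commutative_square_Mat)
  have e: "q \<cdot>\<^bsub>Mat\<^esub> i = k \<cdot>\<^bsub>Mat\<^esub> j" using sq' by (simp add: commutative_square_def)
  have "tgt q \<in> Ob Mat" using q by (simp add: Hom_Mat)
  then obtain u where u: "u \<in> Hom Mat (tgt j') (tgt q)" "u \<cdot>\<^bsub>Mat\<^esub> j' = q"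
    using cocartesian_desc[OF c _ _ _ e] q k s by auto
  then have "fn q y = fn u (fn j' y)" using comp_eq_arrow_iff[OF H(3) u(1) q] y(1) by simp
  also have "\<dots> = pt (tgt q)" using y(2) u(1) by (simp add: Hom_Mat strong_map_pt)
  finally show ?thesis using ker[OF y(1)] by blast
qed

text \<open>The missing corner is the restriction of the source of \<open>j'\<close> to the preimage
  \<open>T\<close> of the image of \<open>i'\<close>, with \<open>k\<close> induced by
  \<open>j'\<close>. \<open>T\<close> contains the kernel of \<open>j'\<close> because the image of
  \<open>i'\<close> contains the point. The work lies in showing that \<open>k\<close> is a quotient
  map.\<close>

lemma cospan_square:
  assumes i': "i' \<in> mat_restrictions" and j': "j' \<in> mat_contractions" and t: "tgt i' = tgt j'"
  obtains i j where "i \<in> mat_restrictions" "j \<in> mat_contractions" "commutative_square Mat i j j' i'"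
    "\<And>y. y \<in> ground (tgt i) \<Longrightarrow> fn j' y = pt (tgt j') \<Longrightarrow> y \<in> fn i ` ground (src i)"
proof -
  have Hi: "i' \<in> Hom Mat (src i') (tgt j')" and ei: "embedding (src i') (tgt j') (fn i')"
    and Hj: "j' \<in> Hom Mat (src j') (tgt j')" and qj: "quotient_map (src j') (tgt j') (fn j')"
    using restriction_in_Hom[OF i'] contraction_in_Hom[OF j'] t by simp_all
  interpret B: pointed_matroid "src j'" using Hj by (simp add: Hom_Mat)
  interpret B': pointed_matroid "tgt j'" using Hj by (simp add: Hom_Mat)
  interpret A': pointed_matroid "src i'" using Hi by (simp add: Hom_Mat)
  have B: "pointed_matroid (src j')" ..
  have A': "pointed_matroid (src i')" ..
  have si: "strong_map (src i') (tgt j') (fn i')" and sj: "strong_map (src j') (tgt j') (fn j')"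
    using Hi Hj by (auto simp: Hom_Mat)
  define T where "T = {y \<in> ground (src j'). fn j' y \<in> fn i' ` ground (src i')}"
  have kT: "y \<in> T" if "y \<in> ground (src j')" "fn j' y = pt (tgt j')" for y
    using that strong_map_pt[OF si] A'.pt_ground by (auto simp: T_def image_iff) metis
  have T: "T \<subseteq> ground (src j')" "pt (src j') \<in> T"
    using kT[OF B.pt_ground strong_map_pt[OF sj]] by (auto simp: T_def)
  define A where "A = restriction (src j') T"
  have A: "pointed_matroid A" and er: "embedding A (src j') (\<lambda>x \<in> T. x)"
    using pointed_matroid_restriction[OF B T] embedding_restriction_map[OF B T] by (simp_all add: A_def)
  have [simp]: "ground A = T" "pt A = pt (src j')" by (simp_all add: A_def)
  interpret A: pointed_matroid A by (rule A)
  have "strong_map A (tgt j') (compose (ground A) (fn j') (\<lambda>x \<in> T. x))"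
    using strong_map_comp[OF A _ sj] er by (simp add: embedding_def)
  moreover have "compose (ground A) (fn j') (\<lambda>x \<in> T. x) ` ground A \<subseteq> fn i' ` ground (src i')"
    by (auto simp: compose_def T_def)
  ultimately obtain k where k: "strong_map A (src i') k"
    and ik0: "\<And>x. x \<in> ground A \<Longrightarrow> fn i' (k x) = compose (ground A) (fn j') (\<lambda>x \<in> T. x) x"
    using embedding_factor[OF A A' ei] by blast
  have ik: "fn i' (k x) = fn j' x" if "x \<in> T" for x using ik0[of x] that by (simp add: compose_def)
  have kapp: "k x \<in> ground (src i')" if "x \<in> T" for x using strong_map_app[OF k] that by simp
  have inj: "inj_on (fn i') (ground (src i'))" using ei by (simp add: embedding_def)
  have fib: "x = y \<or> fn j' x = pt (tgt j')"
    if "x \<in> ground (src j')" "y \<in> ground (src j')" "fn j' x = fn j' y" for x y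
    using quotient_map_fibre[OF qj that] .
  have "quotient_map A (src i') k"
    unfolding quotient_map_def
  proof (intro conjI ballI allI impI k)
    show "k ` ground A = ground (src i')"
    proof
      show "ground (src i') \<subseteq> k ` ground A"
      proof
        fix a assume a: "a \<in> ground (src i')"
        then have "fn i' a \<in> ground (tgt j')" by (rule strong_map_app[OF si])
        then obtain y where y: "y \<in> ground (src j')" "fn i' a = fn j' y"
          using quotient_map_surj[OF qj] by blast
        then have yT: "y \<in> T" using a by (auto simp: T_def image_iff) metis
        then have "fn i' (k y) = fn i' a" using ik y by simp
        then have "k y = a" using inj kapp[OF yT] a by (auto simp: inj_on_def)
        then show "a \<in> k ` ground A" using yT by auto
      qed
    qed (use kapp in auto)
    fix x y assume xy: "x \<in> ground A" "y \<in> ground A" "k x = k y"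
    then have "fn j' x = fn j' y" using ik[of x] ik[of y] by simp
    then have "x = y \<or> fn i' (k x) = fn i' (pt (src i'))"
      using fib[of x y] ik[of x] xy T(1) strong_map_pt[OF si] by auto
    then show "x = y \<or> k x = pt (src i')"
      using inj kapp[of x] A'.pt_ground xy by (auto simp: inj_on_def)
  next
    fix F assume F: "F \<subseteq> ground (src i')" "{x \<in> ground A. k x \<in> F} \<in> flats A"
    then obtain G where G: "G \<in> flats (src j')" "{x \<in> T. k x \<in> F} = G \<inter> T"
      using T by (auto simp: A_def B.flats_restriction)
    have GT: "k y \<in> F \<longleftrightarrow> y \<in> G" if "y \<in> T" for y using G(2) that by blast
    have "k (pt A) \<in> F" using A.pt_flat[OF F(2)] by simp
    then have ptF: "pt (src i') \<in> F" using strong_map_pt[OF k] by simp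
    \<comment> \<open>The trace of \<open>G\<close> on \<open>T\<close> is the preimage of
      \<open>F\<close>, which contains the kernel of \<open>j'\<close>. So \<open>G\<close> is a
      union of fibres of \<open>j'\<close>, its image under \<open>j'\<close> is a flat, and pulling
      that flat back along \<open>i'\<close> returns \<open>F\<close>.\<close>
    have kG: "y \<in> G" if y: "y \<in> ground (src j')" "fn j' y = pt (tgt j')" for y
    proof -
      have "fn i' (k y) = fn i' (pt (src i'))" using ik[OF kT[OF y]] y strong_map_pt[OF si] by simp
      then have "k y = pt (src i')" using inj kapp[OF kT[OF y]] A'.pt_ground by (auto simp: inj_on_def)
      then show ?thesis using GT[OF kT[OF y]] ptF by simp
    qed
    have Gs: "G \<subseteq> ground (src j')" using B.flat_subset[OF G(1)] .
    have sat: "y \<in> G \<longleftrightarrow> fn j' y \<in> fn j' ` G" if y: "y \<in> ground (src j')" for y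
    proof
      assume "fn j' y \<in> fn j' ` G"
      then obtain z where z: "z \<in> G" "fn j' y = fn j' z" by blast
      then show "y \<in> G" using fib[OF y _ z(2)] kG[OF y] Gs by auto
    qed auto
    then have "{y \<in> ground (src j'). fn j' y \<in> fn j' ` G} = G" using Gs by blast
    moreover have "fn j' ` G \<subseteq> ground (tgt j')" using strong_map_app[OF sj] Gs by auto
    ultimately have "fn j' ` G \<in> flats (tgt j')" using G(1) by (intro quotient_map_flat[OF qj]) auto
    then have "{a \<in> ground (src i'). fn i' a \<in> fn j' ` G} \<in> flats (src i')" by (rule strong_map_flat[OF si])
    moreover have "a \<in> F \<longleftrightarrow> fn i' a \<in> fn j' ` G" if a: "a \<in> ground (src i')" for a
    proof -
      have "fn i' a \<in> ground (tgt j')" using a by (rule strong_map_app[OF si])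
      then obtain y where y: "y \<in> ground (src j')" "fn i' a = fn j' y"
        using quotient_map_surj[OF qj] by blast
      then have yT: "y \<in> T" using a by (auto simp: T_def image_iff) metis
      have "k y = a" using inj kapp[OF yT] a ik[OF yT] y by (auto simp: inj_on_def)
      then have "a \<in> F \<longleftrightarrow> y \<in> G" using GT[OF yT] by simp
      then show ?thesis using sat[OF y(1)] y(2) by simp
    qed
    then have "{a \<in> ground (src i'). fn i' a \<in> fn j' ` G} = F" using F(1) by blast
    ultimately show "F \<in> flats (src i')" by simp
  qed
  then have 2: "\<lparr>src = A, tgt = src i', fn = k\<rparr> \<in> mat_contractions"
    using A A' by (simp add: mat_contractions_iff)
  have 1: "\<lparr>src = A, tgt = src j', fn = (\<lambda>x \<in> T. x)\<rparr> \<in> mat_restrictions"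
    using A B er by (simp add: mat_restrictions_iff)
  have 3: "commutative_square Mat \<lparr>src = A, tgt = src j', fn = (\<lambda>x \<in> T. x)\<rparr> \<lparr>src = A, tgt = src i', fn = k\<rparr> j' i'"
    using Hi Hj restriction_in_Hom(1)[OF 1] contraction_in_Hom(1)[OF 2] ik
    by (simp add: commutative_square_Mat)
  show thesis using that[OF 1 2 3] kT by simp
qed

lemma bicartesian_if_kernel:
  assumes "i \<in> mat_restrictions" "i' \<in> mat_restrictions" "j \<in> mat_contractions" "j' \<in> mat_contractions"
    and "commutative_square Mat i j j' i'"
    and "\<And>y. y \<in> ground (tgt i) \<Longrightarrow> fn j' y = pt (tgt j') \<Longrightarrow> y \<in> fn i ` ground (src i)"
  shows "bicartesian Mat i j j' i'"
  unfolding bicartesian_def using cartesian_if_kernel[OF assms] cocartesian_if_kernel[OF assms] ..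

section \<open>The proto-exact structure\<close>

lemma pointed_matroid_singleton:
  "pointed_matroid \<lparr>ground = {a}, cl = (\<lambda>S \<in> Pow {a}. {a}), pt = a\<rparr>"
  by unfold_locales auto

text \<open>The only flat of a one-point matroid is the point itself, which leaves no choice for
  maps in either direction and makes the flat conditions of both admissible classes
  immediate.\<close>

lemma zero_object_singleton:
  assumes Z: "pointed_matroid Z" and g: "ground Z = {pt Z}"
  shows "zero_object Mat Z" "\<And>A. Hom Mat Z A \<subseteq> mat_restrictions" "\<And>A. Hom Mat A Z \<subseteq> mat_contractions"
proof -
  interpret Z: pointed_matroid Z by fact
  have fl: "flats Z = {{pt Z}}"
    using Z.flat_subset Z.pt_flat Z.ground_flat g by auto
  show "zero_object Mat Z"
    unfolding zero_object_def
  proof (intro conjI ballI)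
    fix A :: "'a pointed_matroid" assume "A \<in> Ob Mat"
    then have A: "pointed_matroid A" by simp
    let ?c = "\<lparr>src = Z, tgt = A, fn = (\<lambda>x \<in> ground Z. pt A)\<rparr>"
    let ?d = "\<lparr>src = A, tgt = Z, fn = (\<lambda>x \<in> ground A. pt Z)\<rparr>"
    have c: "?c \<in> Hom Mat Z A" and d: "?d \<in> Hom Mat A Z"
      using Z A strong_map_const by (auto simp: Hom_Mat)
    show "\<exists>!f. f \<in> Hom Mat Z A"
    proof (rule ex1I[of _ ?c])
      fix f assume f: "f \<in> Hom Mat Z A"
      show "f = ?c" using f g by (intro arrow_eqI[OF f c]) (auto simp: Hom_Mat strong_map_pt)
    qed (rule c)
    show "\<exists>!f. f \<in> Hom Mat A Z"
    proof (rule ex1I[of _ ?d])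
      fix f assume f: "f \<in> Hom Mat A Z"
      then have "fn f x = pt Z" if "x \<in> ground A" for x
        using strong_map_app[of A Z "fn f" x] that g by (simp add: Hom_Mat)
      then show "f = ?d" by (intro arrow_eqI[OF f d]) simp
    qed (rule d)
  qed (use Z in simp)
  fix A
  show "Hom Mat Z A \<subseteq> mat_restrictions"
  proof
    fix f assume f: "f \<in> Hom Mat Z A"
    then interpret A: pointed_matroid A by (simp add: Hom_Mat)
    have "fn f (pt Z) = pt A" using f strong_map_pt by (auto simp: Hom_Mat)
    then have "embedding Z A (fn f)"
      using f g fl A.ground_flat A.pt_ground by (auto simp: embedding_def Hom_Mat)
    then show "f \<in> mat_restrictions" using f by (simp add: mat_restrictions_iff Hom_Mat)
  qed
  show "Hom Mat A Z \<subseteq> mat_contractions"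
  proof
    fix f assume f: "f \<in> Hom Mat A Z"
    then interpret A: pointed_matroid A by (simp add: Hom_Mat)
    have sf: "strong_map A Z (fn f)" using f by (simp add: Hom_Mat)
    have c: "fn f x = pt Z" if "x \<in> ground A" for x
      using strong_map_app[OF sf that] g by simp
    have "quotient_map A Z (fn f)"
      unfolding quotient_map_def
    proof (intro conjI ballI allI impI sf)
      show "fn f ` ground A = ground Z" using c g A.pt_ground by auto
      fix F assume F: "F \<subseteq> ground Z" "{x \<in> ground A. fn f x \<in> F} \<in> flats A"
      then have "pt Z \<in> F" using A.pt_flat[OF F(2)] c[OF A.pt_ground] by simp
      then show "F \<in> flats Z" using F g fl by auto
    qed (use c in simp)
    then show "f \<in> mat_contractions" using f by (simp add: mat_contractions_iff Hom_Mat)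
  qed
qed

text \<open>The identity and the constant map to the point are both endomorphisms, so uniqueness
  forces them to agree. Extensions may be formed with any zero object, not just the chosen one,
  which is why this converse is required.\<close>

lemma ground_zero_object:
  assumes "zero_object Mat Z"
  shows "ground Z = {pt Z}"
proof -
  have Z: "pointed_matroid Z" using assms by (simp add: zero_object_def)
  interpret Z: pointed_matroid Z by fact
  have "Idn Mat Z \<in> Hom Mat Z Z" using Z by (intro Mat.Idn_in_Hom) simp
  moreover have "\<lparr>src = Z, tgt = Z, fn = (\<lambda>x \<in> ground Z. pt Z)\<rparr> \<in> Hom Mat Z Z"
    using Z strong_map_const by (auto simp: Hom_Mat)
  ultimately have "Idn Mat Z = \<lparr>src = Z, tgt = Z, fn = (\<lambda>x \<in> ground Z. pt Z)\<rparr>"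
    using assms Z unfolding zero_object_def by (metis Mat_simps(1) mem_Collect_eq)
  then have eq: "(\<lambda>x \<in> ground Z. x) = (\<lambda>x \<in> ground Z. pt Z)" by simp
  have "x = pt Z" if "x \<in> ground Z" for x using fun_cong[OF eq, of x] that by simp
  then show ?thesis using Z.pt_ground by blast
qed

lemma proto_exact_Mat:
  "proto_exact_category (Mat :: ('a pointed_matroid, 'a mat_arrow) cat) mat_restrictions mat_contractions"
proof
  show "mat_restrictions \<subseteq> Ar Mat" "mat_contractions \<subseteq> Ar Mat"
    by (auto simp: mat_restrictions_def mat_contractions_def)
  show "\<exists>Z :: 'a pointed_matroid. zero_object Mat Z \<and>
      (\<forall>A \<in> Ob Mat. Hom Mat Z A \<subseteq> mat_restrictions \<and> Hom Mat A Z \<subseteq> mat_contractions)"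
    using zero_object_singleton[OF pointed_matroid_singleton] by fastforce
  fix f g i j j' i' :: "'a mat_arrow"
  show "g \<cdot>\<^bsub>Mat\<^esub> f \<in> mat_restrictions"
    if "f \<in> mat_restrictions" "g \<in> mat_restrictions" "Cod Mat f = Dom Mat g"
    using that by (auto simp: mat_restrictions_iff intro: embedding_comp)
  show "g \<cdot>\<^bsub>Mat\<^esub> f \<in> mat_contractions"
    if "f \<in> mat_contractions" "g \<in> mat_contractions" "Cod Mat f = Dom Mat g"
    using that by (auto simp: mat_contractions_iff intro: quotient_map_comp)
  have "f \<in> Hom Mat (src f) (tgt f)" if "f \<in> isomorphisms Mat" for f :: "'a mat_arrow"
    using that by (simp add: isomorphisms_def Hom_def)
  then show "isomorphisms (Mat :: ('a pointed_matroid, 'a mat_arrow) cat) \<subseteq> mat_restrictions"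
    "isomorphisms (Mat :: ('a pointed_matroid, 'a mat_arrow) cat) \<subseteq> mat_contractions"
    using isomorphism_embedding isomorphism_quotient_map
    by (fastforce simp: mat_restrictions_iff mat_contractions_iff Hom_Mat)+
  show "cartesian Mat i j j' i' \<longleftrightarrow> cocartesian Mat i j j' i'"
    if "i \<in> mat_restrictions" "i' \<in> mat_restrictions" "j \<in> mat_contractions" "j' \<in> mat_contractions"
      and "commutative_square Mat i j j' i'"
    using cartesian_if_kernel[OF that] cocartesian_if_kernel[OF that]
      kernel_if_cartesian[OF that(4)] kernel_if_cocartesian[OF that(1,3)] by blast
  show "\<exists>i \<in> mat_restrictions. \<exists>j \<in> mat_contractions. bicartesian Mat i j j' i'"
    if "i' \<in> mat_restrictions" "j' \<in> mat_contractions" "Cod Mat i' = Cod Mat j'"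
  proof -
    from that(3) have "tgt i' = tgt j'" by simp
    from cospan_square[OF that(1,2) this] obtain i j
      where "i \<in> mat_restrictions" "j \<in> mat_contractions" "commutative_square Mat i j j' i'"
        "\<And>y. y \<in> ground (tgt i) \<Longrightarrow> fn j' y = pt (tgt j') \<Longrightarrow> y \<in> fn i ` ground (src i)" by blast
    with bicartesian_if_kernel[OF _ that(1) _ that(2)] show ?thesis by blast
  qed
  show "\<exists>i' \<in> mat_restrictions. \<exists>j' \<in> mat_contractions. bicartesian Mat i j j' i'"
    if "i \<in> mat_restrictions" "j \<in> mat_contractions" "Dom Mat i = Dom Mat j"
  proof -
    from that(3) have "src i = src j" by simp
    from span_square[OF that(1,2) this] obtain i' j'
      where "i' \<in> mat_restrictions" "j' \<in> mat_contractions" "commutative_square Mat i j j' i'"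
        "\<And>y. y \<in> ground (tgt i) \<Longrightarrow> fn j' y = pt (tgt j') \<Longrightarrow> y \<in> fn i ` ground (src i)" by blast
    with bicartesian_if_kernel[OF that(1) _ that(2)] show ?thesis by blast
  qed
qed

lemma finite_Hom_Mat: "finite (Hom Mat A B)"
proof (cases "pointed_matroid A \<and> pointed_matroid B")
  case True
  then have "finite (ground A \<rightarrow>\<^sub>E ground B)"
    by (intro finite_PiE) (auto simp: pointed_matroid_def matroid.finite_ground)
  moreover have "Hom Mat A B \<subseteq> (\<lambda>f. \<lparr>src = A, tgt = B, fn = f\<rparr>) ` (ground A \<rightarrow>\<^sub>E ground B)"
  proof
    fix f assume "f \<in> Hom Mat A B"
    then have "f = \<lparr>src = A, tgt = B, fn = fn f\<rparr>" "fn f \<in> ground A \<rightarrow>\<^sub>E ground B"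
      by (auto simp: Hom_Mat strong_map_def)
    then show "f \<in> (\<lambda>f. \<lparr>src = A, tgt = B, fn = f\<rparr>) ` (ground A \<rightarrow>\<^sub>E ground B)" by (rule image_eqI)
  qed
  ultimately show ?thesis using finite_surj by blast
next
  case False
  then have "Hom Mat A B = {}" by (auto simp: Hom_Mat)
  then show ?thesis by simp
qed

section \<open>Finiteness\<close>

text \<open>
  A flat \<open>F\<close> of the middle term can be recovered from its trace on the left term and its image in
  the right term, which makes this a complete invariant with finitely many values.
\<close>

definition extension_flats :: "'a mat_arrow \<times> 'a mat_arrow \<Rightarrow> ('a set \<times> 'a set) set" where
  "extension_flats = (\<lambda>(i, p). (\<lambda>F. ({a \<in> ground (src i). fn i a \<in> F}, fn p ` F)) ` flats (src p))"

text \<open>The last claim is exactness in the middle: the kernel of \<open>p\<close> lies in the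
  image of \<open>i\<close> by the kernel criterion, and conversely \<open>p\<close> after
  \<open>i\<close> passes through a zero object, so it is constant.\<close>

lemma extension_MatD:
  assumes "(i, p) \<in> extensions Mat mat_restrictions mat_contractions D A"
  shows "i \<in> Hom Mat A (src p)" "embedding A (src p) (fn i)"
    "p \<in> Hom Mat (src p) D" "quotient_map (src p) D (fn p)"
    "\<And>x. x \<in> ground (src p) \<Longrightarrow> fn p x = pt D \<longleftrightarrow> x \<in> fn i ` ground A"
proof -
  obtain Z l b where i: "i \<in> mat_restrictions" and p: "p \<in> mat_contractions" 
    and ends: "src i = A" "tgt p = D"
    and Z: "zero_object Mat Z" and l: "l \<in> Hom Mat A Z" and b: "b \<in> Hom Mat Z D"
    and bc: "bicartesian Mat i l p b"
    using assms by (auto simp: extensions_def)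
  have c: "cartesian Mat i l p b" using bc by (simp add: bicartesian_def)
  then have sq: "commutative_square Mat i l p b" by (simp add: cartesian_def)
  then have s: "tgt i = src p" by (simp add: commutative_square_def)
  show "i \<in> Hom Mat A (src p)" "embedding A (src p) (fn i)"
    using restriction_in_Hom[OF i] ends s by simp_all
  show "p \<in> Hom Mat (src p) D" "quotient_map (src p) D (fn p)"
    using contraction_in_Hom[OF p] ends by simp_all
  fix x assume x: "x \<in> ground (src p)"
  show "fn p x = pt D \<longleftrightarrow> x \<in> fn i ` ground A"
  proof
    assume "fn p x = pt D"
    then show "x \<in> fn i ` ground A" using kernel_if_cartesian[OF p c] x ends s by simp
  next
    assume "x \<in> fn i ` ground A"
    then obtain a where a: "a \<in> ground A" "x = fn i a" by blast
    have "fn p x = fn b (fn l a)" using sq a ends by (simp add: commutative_square_Mat)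
    moreover have "fn l a = pt Z"
      using ground_zero_object[OF Z] l a strong_map_app by (fastforce simp: Hom_Mat)
    ultimately show "fn p x = pt D" using b strong_map_pt by (auto simp: Hom_Mat)
  qed
qed

text \<open>The isomorphism \<open>\<phi>\<close> maps the flats of one middle term onto those of
  the other, and its compatibility with the outer maps preserves the trace on \<open>A\<close> and
  the image in \<open>D\<close>.\<close>

lemma extension_flats_eq_if_equiv:
  assumes "((i, p), (i', p')) \<in> extension_equiv Mat mat_restrictions mat_contractions D A"
  shows "extension_flats (i, p) = extension_flats (i', p')"
proof -
  let ?ext = "extensions Mat mat_restrictions mat_contractions D A"
  from assms obtain \<phi> where e: "(i, p) \<in> ?ext" "(i', p') \<in> ?ext"
    and iso: "\<phi> \<in> isomorphisms Mat" and \<phi>: "\<phi> \<in> Hom Mat (tgt i) (tgt i')"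
    and c: "\<phi> \<cdot>\<^bsub>Mat\<^esub> i = i'" "p' \<cdot>\<^bsub>Mat\<^esub> \<phi> = p"
    by (auto simp: extension_equiv_def)
  note E = extension_MatD[OF e(1)] and E' = extension_MatD[OF e(2)]
  have s: "tgt i = src p" "tgt i' = src p'" "src i = A" "src i' = A" using E(1) E'(1) by (auto simp: Hom_Mat)
  note \<phi> = \<phi>[unfolded s]
  have ci: "fn \<phi> (fn i a) = fn i' a" if "a \<in> ground A" for a
    using comp_eq_arrow_iff[OF E(1) \<phi> E'(1)] c that by simp
  have cp: "fn p' (fn \<phi> x) = fn p x" if "x \<in> ground (src p)" for x
    using comp_eq_arrow_iff[OF \<phi> E'(3) E(3)] c that by simp
  have bij: "bij_betw (fn \<phi>) (ground (src p)) (ground (src p'))"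
    and im: "\<And>F. F \<in> flats (src p) \<Longrightarrow> fn \<phi> ` F \<in> flats (src p')"
    using isomorphismE[OF iso \<phi>] by auto
  have app: "fn i a \<in> ground (src p)" if "a \<in> ground A" for a
    using E(1) that by (auto simp: Hom_Mat strong_map_app)
  have sub: "F \<subseteq> ground (src p)" if "F \<in> flats (src p)" for F
    using E(1) that by (auto simp: Hom_Mat pointed_matroid_def dest: matroid.flat_subset)
  have sub': "F \<subseteq> ground (src p')" if "F \<in> flats (src p')" for F
    using E'(1) that by (auto simp: Hom_Mat pointed_matroid_def dest: matroid.flat_subset)
  have 1: "{a \<in> ground A. fn i a \<in> F} = {a \<in> ground A. fn i' a \<in> fn \<phi> ` F} \<and> fn p ` F = fn p' ` fn \<phi> ` F"
    if F: "F \<in> flats (src p)" for F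
  proof
    have "fn i a \<in> F \<longleftrightarrow> fn \<phi> (fn i a) \<in> fn \<phi> ` F" if "a \<in> ground A" for a
      using bij sub[OF F] app[OF that] by (auto simp: bij_betw_def inj_on_def)
    then show "{a \<in> ground A. fn i a \<in> F} = {a \<in> ground A. fn i' a \<in> fn \<phi> ` F}" using ci by auto
    show "fn p ` F = fn p' ` fn \<phi> ` F" using cp sub[OF F] by (force simp: image_image)
  qed
  have 2: "\<exists>F \<in> flats (src p). F' = fn \<phi> ` F" if F': "F' \<in> flats (src p')" for F'
  proof
    show "{x \<in> ground (src p). fn \<phi> x \<in> F'} \<in> flats (src p)"
      using \<phi> strong_map_flat[OF _ F'] by (simp add: Hom_Mat)
    show "F' = fn \<phi> ` {x \<in> ground (src p). fn \<phi> x \<in> F'}"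
      using bij sub'[OF F'] by (auto simp: bij_betw_def)
  qed
  have "flats (src p') = (`) (fn \<phi>) ` flats (src p)" using 2 im by blast
  then show ?thesis
    using 1 by (auto simp: extension_flats_def s image_image intro!: image_cong)
qed

text \<open>By exactness the middle term splits as a set into the image of \<open>A\<close> and a
  copy of \<open>D\<close> without its point. The bijection \<open>w\<close> that respects both
  pieces is therefore dictated, and equality of the invariants makes it match flats with
  flats.\<close>

lemma extension_equiv_if_flats_eq:
  assumes e: "(i, p) \<in> extensions Mat mat_restrictions mat_contractions D A"
    "(i', p') \<in> extensions Mat mat_restrictions mat_contractions D A"
    and eq: "extension_flats (i, p) = extension_flats (i', p')"
  shows "((i, p), (i', p')) \<in> extension_equiv Mat mat_restrictions mat_contractions D A"
proof -
  note E = extension_MatD[OF e(1)] and E' = extension_MatD[OF e(2)]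
  let ?B = "ground (src p)" and ?B' = "ground (src p')"
  have s: "tgt i = src p" "tgt i' = src p'" "src i = A" "src i' = A" using E(1) E'(1) by (auto simp: Hom_Mat)
  interpret B: pointed_matroid "src p" using E by (simp add: Hom_Mat)
  interpret B': pointed_matroid "src p'" using E' by (simp add: Hom_Mat)
  interpret A: pointed_matroid A using E by (simp add: Hom_Mat)
  have si: "strong_map A (src p) (fn i)" and si': "strong_map A (src p') (fn i')"
    and sp: "strong_map (src p) D (fn p)" and sp': "strong_map (src p') D (fn p')"
    using E E' by (auto simp: Hom_Mat)
  have inj: "inj_on (fn i) (ground A)" and inj': "inj_on (fn i') (ground A)"
    using E(2) E'(2) by (auto simp: embedding_def)
  \<comment> \<open>On the image of \<open>A\<close> the element is carried from \<open>i\<close> to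
    \<open>i'\<close>. Elsewhere \<open>p x\<close> is not the point, so the element picked by
    \<open>SOME\<close> is the only one in its fibre of \<open>p'\<close>.\<close>
  define w where "w = (\<lambda>x. if x \<in> fn i ` ground A then fn i' (inv_into (ground A) (fn i) x)
    else SOME y. y \<in> ?B' \<and> fn p' y = fn p x)"
  have wi: "w (fn i a) = fn i' a" if "a \<in> ground A" for a
    using that inj by (simp add: w_def)
  have wB: "w x \<in> ?B' \<and> fn p' (w x) = fn p x" if x: "x \<in> ?B" for x
  proof (cases "x \<in> fn i ` ground A")
    case True
    then obtain a where a: "a \<in> ground A" "x = fn i a" by blast
    have "fn i' a \<in> ?B'" using si' a(1) by (rule strong_map_app)
    then show ?thesis using E(5)[OF x] E'(5)[of "fn i' a"] a wi by auto
  next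
    case False
    have "\<exists>y. y \<in> ?B' \<and> fn p' y = fn p x"
      using quotient_map_surj[OF E'(4) strong_map_app[OF sp x]] by metis
    from someI_ex[OF this] show ?thesis using False by (simp add: w_def)
  qed
  have fib: "x = y" if "x \<in> ?B" "y \<in> ?B" "fn p x = fn p y" "fn p x \<noteq> pt D" for x y
    using quotient_map_fibre[OF E(4) that(1-3)] that(4) by blast
  have fib': "x = y" if "x \<in> ?B'" "y \<in> ?B'" "fn p' x = fn p' y" "fn p' x \<noteq> pt D" for x y
    using quotient_map_fibre[OF E'(4) that(1-3)] that(4) by blast
  have "inj_on w ?B"
  proof (rule inj_onI)
    fix x y assume xy: "x \<in> ?B" "y \<in> ?B" "w x = w y"
    then have eq: "fn p x = fn p y" using wB by metis
    show "x = y"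
    proof (cases "fn p x = pt D")
      case True
      obtain a where a: "a \<in> ground A" "x = fn i a" using E(5)[OF xy(1)] True by auto
      obtain b where b: "b \<in> ground A" "y = fn i b" using E(5)[OF xy(2)] True eq by auto
      have "fn i' a = fn i' b" using xy(3) a b wi by simp
      then show ?thesis using inj' a b by (auto simp: inj_on_def)
    qed (use fib xy eq in blast)
  qed
  moreover have "w ` ?B = ?B'"
  proof
    show "?B' \<subseteq> w ` ?B"
    proof
      fix y assume y: "y \<in> ?B'"
      show "y \<in> w ` ?B"
      proof (cases "fn p' y = pt D")
        case True
        then obtain a where a: "a \<in> ground A" "y = fn i' a" using E'(5)[OF y] by auto
        then have "y = w (fn i a)" using wi by simp
        then show ?thesis using strong_map_app[OF si a(1)] by simp
      next
        case False
        obtain x where x: "x \<in> ?B" "fn p' y = fn p x"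
          using quotient_map_surj[OF E(4) strong_map_app[OF sp' y]] by blast
        then have "y = w x" using fib'[OF y, of "w x"] wB[OF x(1)] False by simp
        then show ?thesis using x by simp
      qed
    qed
  qed (use wB in auto)
  ultimately have bij: "bij_betw w ?B ?B'" by (simp add: bij_betw_def)
  \<comment> \<open>Flats with equal invariants correspond under \<open>w\<close>: on the kernel of
    \<open>p\<close> membership is read off from the trace on \<open>A\<close>; off the kernel the
    fibres are singletons, so it is read off from the image in \<open>D\<close>.\<close>
  have w_flat: "{x \<in> ?B. w x \<in> F'} = F"
    if F: "F \<in> flats (src p)" and F': "F' \<in> flats (src p')"
      and 1: "{a \<in> ground A. fn i a \<in> F} = {a \<in> ground A. fn i' a \<in> F'}" and 2: "fn p ` F = fn p' ` F'"
    for F F'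
  proof -
    have "w x \<in> F' \<longleftrightarrow> x \<in> F" if x: "x \<in> ?B" for x
    proof (cases "fn p x = pt D")
      case True
      then obtain a where a: "a \<in> ground A" "x = fn i a" using E(5)[OF x] by auto
      then show ?thesis using 1 wi by auto
    next
      case False
      have "x \<in> F \<longleftrightarrow> fn p x \<in> fn p ` F"
      proof
        assume "fn p x \<in> fn p ` F"
        then obtain z where z: "z \<in> F" "fn p x = fn p z" by blast
        then show "x \<in> F" using fib[OF x _ z(2) False] B.flat_subset[OF F] by blast
      qed (rule imageI)
      moreover have "w x \<in> F' \<longleftrightarrow> fn p' (w x) \<in> fn p' ` F'"
      proof
        assume "fn p' (w x) \<in> fn p' ` F'"
        then obtain z where z: "z \<in> F'" "fn p' (w x) = fn p' z" by blast
        have "fn p' (w x) \<noteq> pt D" using wB[OF x] False by simp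
        then show "w x \<in> F'" using fib'[OF _ _ z(2)] wB[OF x] z(1) B'.flat_subset[OF F'] by blast
      qed (rule imageI)
      ultimately show ?thesis using wB[OF x] 2 by simp
    qed
    then show ?thesis using B.flat_subset[OF F] by blast
  qed
  define \<phi> where "\<phi> = \<lparr>src = src p, tgt = src p', fn = restrict w ?B\<rparr>"
  have "strong_map (src p) (src p') (restrict w ?B)"
  proof (rule strong_map_restrictI)
    show "w (pt (src p)) = pt (src p')"
      using wi[OF A.pt_ground] strong_map_pt[OF si] strong_map_pt[OF si'] by simp
    fix F' assume F': "F' \<in> flats (src p')"
    then have "({a \<in> ground A. fn i' a \<in> F'}, fn p' ` F') \<in> extension_flats (i, p)"
      unfolding eq by (auto simp: extension_flats_def s)
    then obtain F where "F \<in> flats (src p)" "{a \<in> ground A. fn i a \<in> F} = {a \<in> ground A. fn i' a \<in> F'}"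
      "fn p ` F = fn p' ` F'"
      by (auto simp: extension_flats_def s)
    then show "{x \<in> ?B. w x \<in> F'} \<in> flats (src p)" using w_flat F' by simp
  qed (use B.pt_ground wB in auto)
  then have \<phi>: "\<phi> \<in> Hom Mat (src p) (src p')"
    using B.pointed_matroid_axioms B'.pointed_matroid_axioms by (simp add: Hom_Mat \<phi>_def)
  have "\<phi> \<in> isomorphisms Mat"
  proof (rule isomorphismI[OF \<phi>])
    show "bij_betw (fn \<phi>) ?B ?B'" using bij by (simp add: \<phi>_def)
    fix F assume F: "F \<in> flats (src p)"
    then have "({a \<in> ground A. fn i a \<in> F}, fn p ` F) \<in> extension_flats (i', p')"
      unfolding eq[symmetric] by (auto simp: extension_flats_def s)
    then obtain F' where F': "F' \<in> flats (src p')"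
      "{a \<in> ground A. fn i a \<in> F} = {a \<in> ground A. fn i' a \<in> F'}" "fn p ` F = fn p' ` F'"
      by (auto simp: extension_flats_def s)
    then have "F = {x \<in> ?B. w x \<in> F'}" using w_flat F by simp
    moreover have "F' \<subseteq> w ` ?B" using B'.flat_subset[OF F'(1)] bij by (simp add: bij_betw_def)
    ultimately have "w ` F = F'" by auto
    moreover have "fn \<phi> ` F = w ` F" using B.flat_subset[OF F] by (auto simp: \<phi>_def)
    ultimately show "fn \<phi> ` F \<in> flats (src p')" using F' by simp
  qed
  moreover have "\<phi> \<cdot>\<^bsub>Mat\<^esub> i = i'"
    using comp_eq_arrow_iff[OF E(1) \<phi> E'(1)] wi strong_map_app[OF si] by (simp add: \<phi>_def)
  moreover have "p' \<cdot>\<^bsub>Mat\<^esub> \<phi> = p"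
    using comp_eq_arrow_iff[OF \<phi> E'(3) E(3)] wB by (simp add: \<phi>_def)
  ultimately show ?thesis using e \<phi> s unfolding extension_equiv_def by auto
qed

text \<open>The classes are exactly the nonempty fibres of \<open>extension_flats\<close> on the
  extensions, and its values are sets of pairs of subsets of two fixed finite ground sets. This
  bound is independent of the middle terms.\<close>

lemma finite_Ext_Mat:
  fixes A D :: "'a pointed_matroid"
  assumes A: "pointed_matroid A" and D: "pointed_matroid D"
  shows "finite (Ext Mat mat_restrictions mat_contractions D A)"
proof -
  let ?X = "extensions Mat mat_restrictions mat_contractions D A"
  let ?R = "extension_equiv Mat mat_restrictions mat_contractions D A"
  have cls: "?R `` {x} = {y \<in> ?X. extension_flats y = extension_flats x}" if x: "x \<in> ?X" for x
  proof -
    have "y \<in> ?X \<and> extension_flats y = extension_flats x" if y: "(x, y) \<in> ?R" for y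
      using y extension_flats_eq_if_equiv[of "fst x" "snd x" "fst y" "snd y"]
      by (auto simp: extension_equiv_def)
    moreover have "(x, y) \<in> ?R" if "y \<in> ?X" "extension_flats y = extension_flats x" for y
      using extension_equiv_if_flats_eq[of "fst x" "snd x" D A "fst y" "snd y"] that x by simp
    ultimately show ?thesis by blast
  qed
  have "extension_flats x \<subseteq> Pow (ground A) \<times> Pow (ground D)" if x: "x \<in> ?X" for x
  proof -
    obtain i p where [simp]: "x = (i, p)" by (cases x)
    note E = extension_MatD[OF x[simplified]]
    have "F \<subseteq> ground (src p)" if "F \<in> flats (src p)" for F
      using E(1) that by (auto simp: Hom_Mat pointed_matroid_def dest: matroid.flat_subset)
    then show ?thesis using E(1,3) by (fastforce simp: extension_flats_def Hom_Mat strong_map_app)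
  qed
  then have "Ext Mat mat_restrictions mat_contractions D A \<subseteq>
      (\<lambda>K. {y \<in> ?X. extension_flats y = K}) ` Pow (Pow (ground A) \<times> Pow (ground D))"
    using cls by (auto simp: Ext_def quotient_def)
  moreover have "finite (ground A)" "finite (ground D)"
    using A D by (auto simp: pointed_matroid_def matroid.finite_ground)
  ultimately show ?thesis
    by (meson finite_Pow_iff finite_SigmaI finite_imageI finite_subset)
qed

theorem theoremA:
  "finitary_proto_exact_category
     (Mat :: ('a pointed_matroid, 'a mat_arrow) cat) mat_restrictions mat_contractions"
  using proto_exact_Mat finite_Hom_Mat finite_Ext_Mat
  by (auto simp: finitary_proto_exact_category_def finitary_proto_exact_category_axioms_def)

end
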